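(* In the setting of the context, fix an initial condition $(\xi_0,\zeta_0)$. Consider the controlled system $$\dot\xi=b\mathbb 1_{\mathcal V}\tilde\phi+b_{u\mathcal V}u_{\mathcal V},\quad \theta=\mathbb 1_{\mathcal V}^T\xi,\qquad \dot\zeta=\check b\mathbb 1_{\mathcal E}\omega+b_{u\mathcal E}u_{\mathcal E},\quad \tilde\mu=\mathbb 1_{\mathcal E}^T\zeta,$$ with $\omega=\mathcal A^T\theta$, $\tilde\phi=-\nabla F(\theta)-\mathcal A\tilde\mu$, $b_{u\mathcal V}=b\begin{bmatrix}I_{o\mathcal V}&\mathbb 1_{\mathcal V}\mathcal A\end{bmatrix}$, $b_{u\mathcal E}=\check bI_{o\mathcal E}$, and initial condition $(\xi_0,\zeta_0)$, and the optimal control problem $$\min_U\int_0^\infty\|U\|_R^2+q_{\mathcal V}(\xi,R_{\mathcal V})+q_{\mathcal E}(\zeta,R_{\mathcal E})\ dt,\qquad U=\begin{bmatrix}u_{\mathcal V}^T&u_{\mathcal E}^T\end{bmatrix}^T,$$ where the minimization is over all stabilizing control inputs $U$. Then $\underline U=\begin{bmatrix}\underline u_{\mathcal V}^T&\underline u_{\mathcal E}^T\end{bmatrix}^T$ given by $$\underline u_{\mathcal V}=-\begin{bmatrix}aI_{o\mathcal V}^Tb^{-1}\\ \check d\mathcal A^T\mathbb 1_{\mathcal V}^T\end{bmatrix}\xi,\qquad \underline u_{\mathcal E}=-\check aI_{o\mathcal E}^T\check b^{-1}\zeta$$ is the optimal solution to this optimal control problem, with $R=\mathrm{blockdiag}[R_{\mathcal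 V},R_{\mathcal E}]$, where $$R_{\mathcal V}^{-1}=\begin{bmatrix}2aI_{o\mathcal V}^Tb^{-1}I_{o\mathcal V}&0\\0&2\check d\end{bmatrix},\qquad R_{\mathcal E}^{-1}=2\check aI_{o\mathcal E}^T\check b^{-1}I_{o\mathcal E},$$ and $$q_{\mathcal V}(\xi,R_{\mathcal V})=\tfrac12\theta^T\mathcal L_{\check d}\theta+\sum_{i\in\mathcal V}\Big[(\theta_i-\theta_i^* )(\nabla F_i(\theta_i)-\nabla F_i(\theta_i^* ))+\sum_{k=2}^{\rho_i}\frac{a_{ik}}{2b_{ik}}\xi_{ik}^2\Big],\qquad q_{\mathcal E}(\zeta,R_{\mathcal E})=\sum_{j\in\mathcal E}\sum_{k=2}^{\check\rho_j}\frac{\check a_{jk}}{2\check b_{jk}}\zeta_{jk}^2,$$ with $\mathcal L_{\check d}=\mathcal A\check d\mathcal A^T$.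
   Context: Notation: $\|x\|_R^2=x^TRx$; $\oplus$ denotes block-diagonal direct sum; $[a_k]_{k\in K}$ denotes stacking into a column vector; $\mathbb 1_n$, $\mathbb 0_n$ are the vectors of ones and zeros in $\mathbb R^n$; $I_{on}:=\begin{bmatrix}\mathbb 0_{n-1}&I_{n-1}\end{bmatrix}^T\in\mathbb R^{n\times(n-1)}$. Optimization problem: $\mathcal G(\mathcal V,\mathcal E)$ is a finite connected directed graph with node set $\mathcal V$, edge set $\mathcal E$ and directed incidence matrix $\mathcal A\in\mathbb R^{|\mathcal V|\times|\mathcal E|}$ (entry $(i,j)$ is $1$ if $i$ is the sink of $j$, $-1$ if $i$ is the source of $j$, $0$ otherwise). For each $i\in\mathcal V$, $F_i:\mathbb R\to\mathbb R$ is convex and continuously differentiable with locally Lipschitz derivative. The problem is to minimize $F(\theta)=\sum_{i\in\mathcal V}F_i(\theta_i)$ over $\theta\in\mathbb R^{|\mathcal V|}$ subject to $\mathcal A^T\theta=0$; $F$ is bounded below on the feasible set. An optimal solution $(\theta^*,\mu^* )\in\mathbb R^{|\mathcal V|}\times\mathbb R^{|\mathcal E|}$ is a pair satisfying the KKT conditions $\nabla F(\theta^* )+\mathcal A\mu^*=0$, $\mathcal A^T\theta^*=0$. States and parameters: $\xi=[\xi_i]_{i\in\mathcal V}$ with $\xi_i=[\xi_{i1},\ldots,\xi_{i\rho_i}]^T\in\mathbb R^{\rho_i}$; $\zeta=[\zeta_j]_{j\in\mathcal E}$ with $\zeta_j=[\zeta_{j1},\ldots,\zeta_{j\check\rho_j}]^T\in\mathbb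 R^{\check\rho_j}$; $\rho_i,\check\rho_j\ge1$ integers. $b=\oplus_{i\in\mathcal V}b_i$ with $b_i=\mathrm{diag}[b_{i1},\ldots,b_{i\rho_i}]$, all $b_{ik}>0$; $a=\oplus_{i\in\mathcal V}a_i$ with $a_i=\mathrm{diag}[a_{i2},\ldots,a_{i\rho_i}]$, $a_{i\rho_i}>\cdots>a_{i2}>0$; $I_{o\mathcal V}=\oplus_{i\in\mathcal V}I_{o\rho_i}$; $\mathbb 1_{\mathcal V}=\oplus_{i\in\mathcal V}\mathbb 1_{\rho_i}$. The matrices $\check b,\check a,I_{o\mathcal E},\mathbb 1_{\mathcal E}$ are defined in the same way from $\check b_{jk}>0$, $\check a_{j\check\rho_j}>\cdots>\check a_{j2}>0$, $\check\rho_j$, $j\in\mathcal E$. $\check d=\oplus_{j\in\mathcal E}\check d_j$ with $\check d_j\ge0$ for all $j\in\mathcal E$ (feed-forward gains). The inputs satisfy $u_{\mathcal V}(t)\in\mathbb R^{\sum_{i\in\mathcal V}(\rho_i-1)+|\mathcal E|}$, $u_{\mathcal E}(t)\in\mathbb R^{\sum_{j\in\mathcal E}(\check\rho_j-1)}$. The dual variable is $\mu=\tilde\mu+\check d\omega$. Stabilizing inputs: with $U=\underline U$ the system is the augmented primal-dual algorithm with feed-forward terms, $\dot\xi=b\mathbb 1_{\mathcal V}\tilde\phi-(I_{o\mathcal V}aI_{o\mathcal V}^T+b\mathbb 1_{\mathcal V}\mathcal L_{\check d}\mathbb 1_{\mathcal V}^T)\xi$, $\dot\zeta=\check b\mathbb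 1_{\mathcal E}\omega-I_{o\mathcal E}\check aI_{o\mathcal E}^T\zeta$, taken to converge from the given initial condition to an equilibrium point at which $(\theta,\mu)$ equals an optimal solution; $(\theta^*,\mu^* )$ denotes this particular optimal solution. A control input $U$ (an arbitrary function of time, allowed at time $t$ to depend on the history of the process up to $t$) is stabilizing if the system states converge to an equilibrium point at which $(\theta,\mu)=(\theta^*,\mu^* )$. *)

theory Defs
  imports "HOL-Analysis.Analysis" "Graph_Theory.Digraph_Component"
begin

text \<open>
  The dimensions of the vectors below depend on the graph and on the parameters \<open>\<rho>\<close>, and may be 0
  (no edges, or all \<open>\<rho>\<close> equal to 1).  Vectors and matrices are therefore functions on index types,
  and every product names the finite index set it sums over; values off the index sets are
  irrelevant.  A stacked vector \<open>[x\<^sub>i]\<^sub>i\<close> with \<open>x\<^sub>i = [x\<^sub>i\<^sub>k]\<^sub>k\<close> is indexed by the pairs \<open>(i,k)\<close>, and a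
  concatenation of two vectors by a sum type.
\<close>

type_synonym 'i vct = "'i \<Rightarrow> real"
type_synonym ('i, 'j) mtx = "'i \<Rightarrow> 'j \<Rightarrow> real"

definition mtx_vec :: "('i, 'j) mtx \<Rightarrow> 'j set \<Rightarrow> 'j vct \<Rightarrow> 'i vct"
    ("(_ \<cdot>\<^bsub>_\<^esub> _)" [76, 0, 75] 75)
  where "M \<cdot>\<^bsub>J\<^esub> x = (\<lambda>i. \<Sum>j\<in>J. M i j * x j)"

definition mtx_mul :: "('i, 'j) mtx \<Rightarrow> 'j set \<Rightarrow> ('j, 'k) mtx \<Rightarrow> ('i, 'k) mtx"
    ("(_ \<odot>\<^bsub>_\<^esub> _)" [76, 0, 77] 76)
  where "M \<odot>\<^bsub>J\<^esub> N = (\<lambda>i k. \<Sum>j\<in>J. M i j * N j k)"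

definition scal_prod :: "'i set \<Rightarrow> 'i vct \<Rightarrow> 'i vct \<Rightarrow> real"
  where "scal_prod J x y = (\<Sum>j\<in>J. x j * y j)"

definition mtx_scale :: "real \<Rightarrow> ('i, 'j) mtx \<Rightarrow> ('i, 'j) mtx"
  where "mtx_scale c M = (\<lambda>i j. c * M i j)"

definition trans_mtx :: "('i, 'j) mtx \<Rightarrow> ('j, 'i) mtx"
  where "trans_mtx M = (\<lambda>j i. M i j)"

definition diag_mtx :: "('i \<Rightarrow> real) \<Rightarrow> ('i, 'i) mtx"
  where "diag_mtx d = (\<lambda>i j. if i = j then d i else 0)"

definition hcat :: "('i, 'j) mtx \<Rightarrow> ('i, 'k) mtx \<Rightarrow> ('i, 'j + 'k) mtx"
  where "hcat M N = (\<lambda>i q. case q of Inl j \<Rightarrow> M i j | Inr k \<Rightarrow> N i k)"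

definition vcat :: "('i, 'j) mtx \<Rightarrow> ('k, 'j) mtx \<Rightarrow> ('i + 'k, 'j) mtx"
  where "vcat M N = (\<lambda>p j. case p of Inl i \<Rightarrow> M i j | Inr k \<Rightarrow> N k j)"

definition blockdiag :: "('i, 'j) mtx \<Rightarrow> ('k, 'l) mtx \<Rightarrow> ('i + 'k, 'j + 'l) mtx"
  where "blockdiag M N = vcat (hcat M (\<lambda>_ _. 0)) (hcat (\<lambda>_ _. 0) N)"

definition dsum :: "('i \<Rightarrow> ('k, 'l) mtx) \<Rightarrow> ('i \<times> 'k, 'i \<times> 'l) mtx"
  where "dsum M = (\<lambda>(i, k) (j, l). if i = j then M i k l else 0)"

text \<open>Direct sum of column vectors: each block has one column, so the columns are indexed by \<open>'i\<close>.\<close>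

definition dsum_col :: "('i \<Rightarrow> 'k vct) \<Rightarrow> ('i \<times> 'k, 'i) mtx"
  where "dsum_col v = (\<lambda>(i, k) j. if i = j then v i k else 0)"

text \<open>
  The matrix \<open>I\<^sub>o\<^sub>n\<close> has rows \<open>1..n\<close>; its \<open>n - 1\<close> columns are labelled \<open>2..n\<close>, like the gains
  \<open>a\<^sub>i\<^sub>2, \<dots>, a\<^sub>i\<^sub>\<rho>\<close>, so that its first row is zero and its other entries are Kronecker deltas.
\<close>

definition Io :: "(nat, nat) mtx"
  where "Io = (\<lambda>k l. if k = l then 1 else 0)"

definition Io_sum :: "('i \<times> nat, 'i \<times> nat) mtx"
  where "Io_sum = dsum (\<lambda>_. Io)"

definition ones_sum :: "('i \<times> nat, 'i) mtx"
  where "ones_sum = dsum_col (\<lambda>_ _. 1)"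

definition gain_mtx :: "('i \<Rightarrow> nat \<Rightarrow> real) \<Rightarrow> ('i \<times> nat, 'i \<times> nat) mtx"
  where "gain_mtx g = dsum (\<lambda>i. diag_mtx (g i))"

definition gain_inv :: "('i \<Rightarrow> nat \<Rightarrow> real) \<Rightarrow> ('i \<times> nat, 'i \<times> nat) mtx"
  where "gain_inv g = gain_mtx (\<lambda>i k. inverse (g i k))"

text \<open>
  \<open>wnorm2 J S u\<close> is \<open>u\<^sup>T R u\<close> for the weight \<open>R\<close> with \<open>R\<^sup>-\<^sup>1 = S\<close>, where \<open>S\<close> is symmetric positive
  semidefinite.  If \<open>S\<close> is invertible, the vector \<open>y\<close> is \<open>R u\<close>.  A vanishing feed-forward gain
  makes \<open>S\<close> singular, i.e. the corresponding weight in \<open>R\<close> infinite: the value is then \<open>\<infinity>\<close> unless \<open>u\<close>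
  lies in the range of \<open>S\<close>, and for such \<open>u\<close> it does not depend on the choice of \<open>y\<close>.
\<close>

definition wnorm2 :: "'i set \<Rightarrow> ('i, 'i) mtx \<Rightarrow> 'i vct \<Rightarrow> ennreal"
  where "wnorm2 J S u =
    (if \<exists>y. \<forall>p\<in>J. (S \<cdot>\<^bsub>J\<^esub> y) p = u p
     then ennreal (scal_prod J u (SOME y. \<forall>p\<in>J. (S \<cdot>\<^bsub>J\<^esub> y) p = u p))
     else \<infinity>)"


section \<open>The optimization problem\<close>

text \<open>
  The fields with suffix \<open>E\<close> are the edge parameters (written with a check accent on paper),
  and \<open>dE\<close> are the feed-forward gains.
\<close>

record ('v, 'e) pd_system =
  graph :: "('v, 'e) pre_digraph"
  obj :: "'v \<Rightarrow> real \<Rightarrow> real"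
  rhoV :: "'v \<Rightarrow> nat"
  bV :: "'v \<Rightarrow> nat \<Rightarrow> real"
  aV :: "'v \<Rightarrow> nat \<Rightarrow> real"
  rhoE :: "'e \<Rightarrow> nat"
  bE :: "'e \<Rightarrow> nat \<Rightarrow> real"
  aE :: "'e \<Rightarrow> nat \<Rightarrow> real"
  dE :: "'e \<Rightarrow> real"

abbreviation nodes :: "('v, 'e) pd_system \<Rightarrow> 'v set" where "nodes S \<equiv> verts (graph S)"
abbreviation edges :: "('v, 'e) pd_system \<Rightarrow> 'e set" where "edges S \<equiv> arcs (graph S)"

definition incidence :: "('v, 'e) pd_system \<Rightarrow> ('v, 'e) mtx"
  where "incidence S = (\<lambda>i j. if i = head (graph S) j then 1
                              else if i = tail (graph S) j then -1 else 0)"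

definition total_obj :: "('v, 'e) pd_system \<Rightarrow> 'v vct \<Rightarrow> real"
  where "total_obj S \<theta> = (\<Sum>i\<in>nodes S. obj S i (\<theta> i))"

text \<open>The gradient of the separable function \<open>total_obj S\<close>.\<close>

definition grad_obj :: "('v, 'e) pd_system \<Rightarrow> 'v vct \<Rightarrow> 'v vct"
  where "grad_obj S \<theta> = (\<lambda>i. deriv (obj S i) (\<theta> i))"

definition feasible :: "('v, 'e) pd_system \<Rightarrow> 'v vct \<Rightarrow> bool"
  where "feasible S \<theta> \<longleftrightarrow> (\<forall>j\<in>edges S. (trans_mtx (incidence S) \<cdot>\<^bsub>nodes S\<^esub> \<theta>) j = 0)"

definition optimal_pair :: "('v, 'e) pd_system \<Rightarrow> 'v vct \<Rightarrow> 'e vct \<Rightarrow> bool"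
  where "optimal_pair S \<theta> \<mu> \<longleftrightarrow>
    (\<forall>i\<in>nodes S. grad_obj S \<theta> i + (incidence S \<cdot>\<^bsub>edges S\<^esub> \<mu>) i = 0) \<and> feasible S \<theta>"

definition admissible_obj :: "(real \<Rightarrow> real) \<Rightarrow> bool"
  where "admissible_obj f \<longleftrightarrow>
    convex_on UNIV f \<and> (\<forall>s. f field_differentiable (at s)) \<and> continuous_on UNIV (deriv f) \<and>
    (\<forall>s. \<exists>r>0. \<exists>L. L-lipschitz_on (cball s r) (deriv f))"

definition admissible_gains :: "nat \<Rightarrow> (nat \<Rightarrow> real) \<Rightarrow> (nat \<Rightarrow> real) \<Rightarrow> bool"
  where "admissible_gains r b a \<longleftrightarrow>
    1 \<le> r \<and> (\<forall>k\<in>{1..r}. 0 < b k) \<and> (\<forall>k\<in>{2..r}. 0 < a k) \<and> strict_mono_on {2..r} a"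

text \<open>
  Connectedness of a digraph is that of the underlying undirected graph.  Loops are excluded, since
  the incidence matrix has a column with entries \<open>1\<close> and \<open>-1\<close> for every edge.
\<close>

definition pd_setting :: "('v, 'e) pd_system \<Rightarrow> bool"
  where "pd_setting S \<longleftrightarrow>
    fin_digraph (graph S) \<and> loopfree_digraph (graph S) \<and> Digraph_Component.connected (graph S) \<and>
    (\<forall>i\<in>nodes S. admissible_obj (obj S i)) \<and>
    bdd_below (total_obj S ` {\<theta>. feasible S \<theta>}) \<and>
    (\<forall>i\<in>nodes S. admissible_gains (rhoV S i) (bV S i) (aV S i)) \<and>
    (\<forall>j\<in>edges S. admissible_gains (rhoE S j) (bE S j) (aE S j)) \<and>
    (\<forall>j\<in>edges S. 0 \<le> dE S j)"


section \<open>The controlled system\<close>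

type_synonym ('v, 'e) state = "('v \<times> nat) vct \<times> ('e \<times> nat) vct"
type_synonym ('v, 'e) inputV = "('v \<times> nat) + 'e"
type_synonym ('v, 'e) input = "('v, 'e) inputV + ('e \<times> nat)"

abbreviation XV :: "('v, 'e) pd_system \<Rightarrow> ('v \<times> nat) set"
  where "XV S \<equiv> (SIGMA i:nodes S. {1..rhoV S i})"
abbreviation XE :: "('v, 'e) pd_system \<Rightarrow> ('e \<times> nat) set"
  where "XE S \<equiv> (SIGMA j:edges S. {1..rhoE S j})"
abbreviation KV :: "('v, 'e) pd_system \<Rightarrow> ('v \<times> nat) set"
  where "KV S \<equiv> (SIGMA i:nodes S. {2..rhoV S i})"
abbreviation KE :: "('v, 'e) pd_system \<Rightarrow> ('e \<times> nat) set"
  where "KE S \<equiv> (SIGMA j:edges S. {2..rhoE S j})"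
abbreviation UV :: "('v, 'e) pd_system \<Rightarrow> ('v, 'e) inputV set"
  where "UV S \<equiv> KV S <+> edges S"
abbreviation UX :: "('v, 'e) pd_system \<Rightarrow> ('v, 'e) input set"
  where "UX S \<equiv> UV S <+> KE S"

definition theta :: "('v, 'e) pd_system \<Rightarrow> ('v, 'e) state \<Rightarrow> 'v vct"
  where "theta S x = trans_mtx ones_sum \<cdot>\<^bsub>XV S\<^esub> fst x"

definition omega :: "('v, 'e) pd_system \<Rightarrow> ('v, 'e) state \<Rightarrow> 'e vct"
  where "omega S x = trans_mtx (incidence S) \<cdot>\<^bsub>nodes S\<^esub> theta S x"

definition mu_tilde :: "('v, 'e) pd_system \<Rightarrow> ('v, 'e) state \<Rightarrow> 'e vct"
  where "mu_tilde S x = trans_mtx ones_sum \<cdot>\<^bsub>XE S\<^esub> snd x"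

definition mu :: "('v, 'e) pd_system \<Rightarrow> ('v, 'e) state \<Rightarrow> 'e vct"
  where "mu S x = (\<lambda>j. mu_tilde S x j + (diag_mtx (dE S) \<cdot>\<^bsub>edges S\<^esub> omega S x) j)"

definition phi_tilde :: "('v, 'e) pd_system \<Rightarrow> ('v, 'e) state \<Rightarrow> 'v vct"
  where "phi_tilde S x =
    (\<lambda>i. - grad_obj S (theta S x) i - (incidence S \<cdot>\<^bsub>edges S\<^esub> mu_tilde S x) i)"

definition b_uV :: "('v, 'e) pd_system \<Rightarrow> ('v \<times> nat, ('v, 'e) inputV) mtx"
  where "b_uV S =
    gain_mtx (bV S) \<odot>\<^bsub>XV S\<^esub> hcat Io_sum (ones_sum \<odot>\<^bsub>nodes S\<^esub> incidence S)"

definition b_uE :: "('v, 'e) pd_system \<Rightarrow> ('e \<times> nat, 'e \<times> nat) mtx"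
  where "b_uE S = gain_mtx (bE S) \<odot>\<^bsub>XE S\<^esub> Io_sum"

definition rhsV :: "('v, 'e) pd_system \<Rightarrow> ('v, 'e) state \<Rightarrow> ('v, 'e) input vct \<Rightarrow> ('v \<times> nat) vct"
  where "rhsV S x u = (\<lambda>p.
    ((gain_mtx (bV S) \<odot>\<^bsub>XV S\<^esub> ones_sum) \<cdot>\<^bsub>nodes S\<^esub> phi_tilde S x) p
    + (b_uV S \<cdot>\<^bsub>UV S\<^esub> (\<lambda>q. u (Inl q))) p)"

definition rhsE :: "('v, 'e) pd_system \<Rightarrow> ('v, 'e) state \<Rightarrow> ('v, 'e) input vct \<Rightarrow> ('e \<times> nat) vct"
  where "rhsE S x u = (\<lambda>p.
    ((gain_mtx (bE S) \<odot>\<^bsub>XE S\<^esub> ones_sum) \<cdot>\<^bsub>edges S\<^esub> omega S x) p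
    + (b_uE S \<cdot>\<^bsub>KE S\<^esub> (\<lambda>q. u (Inr q))) p)"

text \<open>
  Trajectories on \<open>[0,\<infinity>)\<close> for an input signal \<open>u\<close> that may be discontinuous: the differential
  equation in integrated form.  The case \<open>t = 0\<close> is the initial condition.
\<close>

definition trajectory ::
    "('v, 'e) pd_system \<Rightarrow> ('v, 'e) state \<Rightarrow> (real \<Rightarrow> ('v, 'e) input vct) \<Rightarrow> (real \<Rightarrow> ('v, 'e) state) \<Rightarrow> bool"
  where "trajectory S x0 u x \<longleftrightarrow> (\<forall>t\<ge>0.
    (\<forall>p\<in>XV S. ((\<lambda>s. rhsV S (x s) (u s) p) has_integral (fst (x t) p - fst x0 p)) {0..t}) \<and>
    (\<forall>p\<in>XE S. ((\<lambda>s. rhsE S (x s) (u s) p) has_integral (snd (x t) p - snd x0 p)) {0..t}))"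

definition converges_to :: "('v, 'e) pd_system \<Rightarrow> (real \<Rightarrow> ('v, 'e) state) \<Rightarrow> ('v, 'e) state \<Rightarrow> bool"
  where "converges_to S x xe \<longleftrightarrow>
    (\<forall>p\<in>XV S. ((\<lambda>t. fst (x t) p) \<longlongrightarrow> fst xe p) at_top) \<and>
    (\<forall>p\<in>XE S. ((\<lambda>t. snd (x t) p) \<longlongrightarrow> snd xe p) at_top)"

text \<open>\<open>xe\<close> is at rest under the constant input \<open>u\<close>.\<close>

definition rest_point :: "('v, 'e) pd_system \<Rightarrow> ('v, 'e) state \<Rightarrow> ('v, 'e) input vct \<Rightarrow> bool"
  where "rest_point S xe u \<longleftrightarrow>
    (\<forall>p\<in>XV S. rhsV S xe u p = 0) \<and> (\<forall>p\<in>XE S. rhsE S xe u p = 0)"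

definition outputs_at :: "('v, 'e) pd_system \<Rightarrow> ('v, 'e) state \<Rightarrow> 'v vct \<Rightarrow> 'e vct \<Rightarrow> bool"
  where "outputs_at S x \<theta> \<mu> \<longleftrightarrow>
    (\<forall>i\<in>nodes S. theta S x i = \<theta> i) \<and> (\<forall>j\<in>edges S. mu S x j = \<mu> j)"


section \<open>The optimal control problem\<close>

text \<open>
  A control gives the input at time \<open>t\<close> as a function of \<open>t\<close> and of the history of the state on
  \<open>[0,t]\<close>; open-loop signals and state feedback are special cases.  A control need not have a unique
  trajectory, so controls are considered together with a trajectory they generate.
\<close>

type_synonym ('v, 'e) control = "real \<Rightarrow> (real \<Rightarrow> ('v, 'e) state) \<Rightarrow> ('v, 'e) input vct"

definition causal :: "('v, 'e) control \<Rightarrow> bool"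
  where "causal U \<longleftrightarrow> (\<forall>t\<ge>0. \<forall>x y. (\<forall>s\<in>{0..t}. x s = y s) \<longrightarrow> U t x = U t y)"

text \<open>
  Measurability of the input signal is what the cost integral needs; nothing else is asked of it.
\<close>

definition stabilizing ::
    "('v, 'e) pd_system \<Rightarrow> ('v, 'e) state \<Rightarrow> 'v vct \<Rightarrow> 'e vct \<Rightarrow>
     ('v, 'e) control \<Rightarrow> (real \<Rightarrow> ('v, 'e) state) \<Rightarrow> bool"
  where "stabilizing S x0 \<theta>s \<mu>s U x \<longleftrightarrow>
    causal U \<and>
    (\<forall>p\<in>UX S. (\<lambda>t. U t x p) \<in> borel_measurable (lebesgue_on {0..})) \<and>
    trajectory S x0 (\<lambda>t. U t x) x \<and>
    (\<exists>xe. converges_to S x xe \<and> (\<exists>u. rest_point S xe u) \<and> outputs_at S xe \<theta>s \<mu>s)"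

definition RV_inv :: "('v, 'e) pd_system \<Rightarrow> (('v, 'e) inputV, ('v, 'e) inputV) mtx"
  where "RV_inv S = blockdiag
    (mtx_scale 2 (gain_mtx (aV S) \<odot>\<^bsub>KV S\<^esub> (trans_mtx Io_sum \<odot>\<^bsub>XV S\<^esub> (gain_inv (bV S) \<odot>\<^bsub>XV S\<^esub> Io_sum))))
    (mtx_scale 2 (diag_mtx (dE S)))"

definition RE_inv :: "('v, 'e) pd_system \<Rightarrow> ('e \<times> nat, 'e \<times> nat) mtx"
  where "RE_inv S =
    mtx_scale 2 (gain_mtx (aE S) \<odot>\<^bsub>KE S\<^esub> (trans_mtx Io_sum \<odot>\<^bsub>XE S\<^esub> (gain_inv (bE S) \<odot>\<^bsub>XE S\<^esub> Io_sum)))"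

definition R_inv :: "('v, 'e) pd_system \<Rightarrow> (('v, 'e) input, ('v, 'e) input) mtx"
  where "R_inv S = blockdiag (RV_inv S) (RE_inv S)"

definition lap :: "('v, 'e) pd_system \<Rightarrow> ('v, 'v) mtx"
  where "lap S = incidence S \<odot>\<^bsub>edges S\<^esub> (diag_mtx (dE S) \<odot>\<^bsub>edges S\<^esub> trans_mtx (incidence S))"

definition qV :: "('v, 'e) pd_system \<Rightarrow> 'v vct \<Rightarrow> ('v, 'e) state \<Rightarrow> real"
  where "qV S \<theta>s x =
    1 / 2 * scal_prod (nodes S) (theta S x) (lap S \<cdot>\<^bsub>nodes S\<^esub> theta S x)
    + (\<Sum>i\<in>nodes S.
        (theta S x i - \<theta>s i) * (deriv (obj S i) (theta S x i) - deriv (obj S i) (\<theta>s i))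
        + (\<Sum>k=2..rhoV S i. aV S i k / (2 * bV S i k) * (fst x (i, k))\<^sup>2))"

definition qE :: "('v, 'e) pd_system \<Rightarrow> ('v, 'e) state \<Rightarrow> real"
  where "qE S x =
    (\<Sum>j\<in>edges S. \<Sum>k=2..rhoE S j. aE S j k / (2 * bE S j k) * (snd x (j, k))\<^sup>2)"

text \<open>
  The coercion to \<open>ennreal\<close> loses nothing: \<open>qV\<close> and \<open>qE\<close> are nonnegative, because the derivative of a
  convex function is monotone.
\<close>

definition cost ::
    "('v, 'e) pd_system \<Rightarrow> 'v vct \<Rightarrow> ('v, 'e) control \<Rightarrow> (real \<Rightarrow> ('v, 'e) state) \<Rightarrow> ennreal"
  where "cost S \<theta>s U x =
    (\<integral>\<^sup>+t\<in>{0..}. (wnorm2 (UX S) (R_inv S) (U t x) + ennreal (qV S \<theta>s (x t) + qE S (x t))) \<partial>lebesgue)"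

text \<open>
  \<open>U\<close>, generating the trajectory \<open>x\<close>, is the optimal control: it is stabilizing, has finite and minimal
  cost among all stabilizing controls, and every stabilizing control of the same cost has the same
  trajectory and, up to a null set of times, the same input signal.
\<close>

definition is_optimal_control ::
    "('v, 'e) pd_system \<Rightarrow> ('v, 'e) state \<Rightarrow> 'v vct \<Rightarrow> 'e vct \<Rightarrow>
     ('v, 'e) control \<Rightarrow> (real \<Rightarrow> ('v, 'e) state) \<Rightarrow> bool"
  where "is_optimal_control S x0 \<theta>s \<mu>s U x \<longleftrightarrow>
    stabilizing S x0 \<theta>s \<mu>s U x \<and>
    cost S \<theta>s U x < \<infinity> \<and>
    (\<forall>U' x'. stabilizing S x0 \<theta>s \<mu>s U' x' \<longrightarrow> cost S \<theta>s U x \<le> cost S \<theta>s U' x') \<and>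
    (\<forall>U' x'. stabilizing S x0 \<theta>s \<mu>s U' x' \<and> cost S \<theta>s U' x' = cost S \<theta>s U x \<longrightarrow>
       (\<forall>t\<ge>0. (\<forall>p\<in>XV S. fst (x' t) p = fst (x t) p) \<and> (\<forall>p\<in>XE S. snd (x' t) p = snd (x t) p)) \<and>
       (AE t in lebesgue_on {0..}. \<forall>p\<in>UX S. U' t x' p = U t x p))"

definition uV_fb :: "('v, 'e) pd_system \<Rightarrow> ('v, 'e) state \<Rightarrow> ('v, 'e) inputV vct"
  where "uV_fb S x = (\<lambda>q. -
    (vcat (gain_mtx (aV S) \<odot>\<^bsub>KV S\<^esub> (trans_mtx Io_sum \<odot>\<^bsub>XV S\<^esub> gain_inv (bV S)))
          (diag_mtx (dE S) \<odot>\<^bsub>edges S\<^esub> (trans_mtx (incidence S) \<odot>\<^bsub>nodes S\<^esub> trans_mtx ones_sum))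
     \<cdot>\<^bsub>XV S\<^esub> fst x) q)"

definition uE_fb :: "('v, 'e) pd_system \<Rightarrow> ('v, 'e) state \<Rightarrow> ('e \<times> nat) vct"
  where "uE_fb S x = (\<lambda>q. -
    ((gain_mtx (aE S) \<odot>\<^bsub>KE S\<^esub> (trans_mtx Io_sum \<odot>\<^bsub>XE S\<^esub> gain_inv (bE S))) \<cdot>\<^bsub>XE S\<^esub> snd x) q)"

definition U_fb :: "('v, 'e) pd_system \<Rightarrow> ('v, 'e) state \<Rightarrow> ('v, 'e) input vct"
  where "U_fb S x = (\<lambda>p. case p of Inl q \<Rightarrow> uV_fb S x q | Inr q \<Rightarrow> uE_fb S x q)"

end

theory Submission
  imports Defs
begin

text \<open>
  Half the squared distance \<open>E\<close> to the equilibrium, weighted by \<open>b\<^sup>-\<^sup>1\<close>, is the value function.  With the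
  output \<open>z = (\<xi>\<^sub>i\<^sub>k (k \<ge> 2), \<omega>, \<zeta>\<^sub>j\<^sub>k (k \<ge> 2))\<close> dual to the input, two trajectories satisfy
  \<open>dE/dt = \<Sum> (z - z') (u - u') - gap\<close>, where \<open>gap \<ge> 0\<close> by monotonicity of the gradient.  The inverse
  weight is diagonal with entries \<open>s\<close>, the proposed control is \<open>u = - s z / 2\<close>, and completing the
  square turns the running cost into \<open>\<Sum> (u + s z / 2)\<^sup>2 / s - dE/dt\<close>.  Finite cost forces the inputs to
  be locally square integrable and \<open>z\<close>, hence \<open>E\<close>, to tend to 0, so the cost is \<open>E(0)\<close> plus the integral
  of the squares.  If that integral vanishes, both trajectories follow the feedback, and the
  distance between them cannot grow.
\<close>

subsection \<open>Block matrices and weighted norms\<close>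

text \<open>The input matrices carry the factor \<open>b\<close>, so weighting the squares by its
  inverse makes the output dual to the input free of gains, and the coupling of nodes and edges
  through the incidence matrix and its transpose is lossless. The state cost is tailored to this
  energy: it equals the sum of \<open>s * z\<^sup>2 / 4\<close> plus \<open>gap\<close>, exactly
  what completing the square in \<open>u\<^sup>2 / s + z * u\<close> needs. Hence the energy solves
  the Hamilton-Jacobi-Bellman equation with value 0 at the equilibrium. Two obstacles shape the
  argument. A vanishing feed-forward gain gives \<open>s = 0\<close>, so the square can be completed
  only for inputs that vanish there, which finite cost guarantees for almost every time. Moreover a
  stabilizing control is merely measurable, and its limit is known only to be at rest with the right
  outputs: under zero input any distribution of \<open>\<theta>\<close> over the components
  \<open>\<xi>\<^sub>i\<^sub>k\<close> is at rest. Integrability of the inputs and convergence to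
  the same equilibrium therefore have to be extracted from finiteness of the cost.\<close>

lemma sum_delta_mult:
  fixes f g :: "'a \<Rightarrow> real"
  assumes "finite A"
  shows "(\<Sum>x\<in>A. (if x = a then f x else 0) * g x) = (if a \<in> A then f a * g a else 0)"
    and "(\<Sum>x\<in>A. (if a = x then f x else 0) * g x) = (if a \<in> A then f a * g a else 0)"
  using assms by (simp_all add: if_distrib[of "\<lambda>z. z * _"] cong: if_cong)

lemma gain_mtx_apply: "gain_mtx g p q = (if p = q then g (fst p) (snd p) else 0)"
  by (cases p; cases q) (auto simp: gain_mtx_def dsum_def diag_mtx_def)

lemma Io_sum_apply: "Io_sum p q = (if p = q then 1 else 0)"
  by (cases p; cases q) (auto simp: Io_sum_def dsum_def Io_def)

lemma ones_sum_apply: "ones_sum p i = (if fst p = i then 1 else 0)"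
  by (cases p) (auto simp: ones_sum_def dsum_col_def)

lemma gain_mtx_mul:
  assumes "finite J" "p \<in> J"
  shows "(gain_mtx g \<odot>\<^bsub>J\<^esub> M) p q = g (fst p) (snd p) * M p q"
proof -
  have "(gain_mtx g \<odot>\<^bsub>J\<^esub> M) p q = (\<Sum>r\<in>J. (if p = r then g (fst r) (snd r) else 0) * M r q)"
    unfolding mtx_mul_def by (intro sum.cong) (auto simp: gain_mtx_apply)
  then show ?thesis
    using assms by (simp only: sum_delta_mult(2) if_True)
qed

lemma trans_Io_sum_mul:
  assumes "finite J" "p \<in> J"
  shows "(trans_mtx Io_sum \<odot>\<^bsub>J\<^esub> M) p q = M p q"
  using assms sum_delta_mult(1)[of J p "\<lambda>_. 1" "\<lambda>r. M r q"]
  by (simp add: mtx_mul_def trans_mtx_def Io_sum_apply)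

text \<open>\<open>Io_sum\<close> is a Kronecker delta, so on rows in \<open>K\<close> both products
  collapse to the diagonal \<open>a / b\<close>. Up to sign the first is a gain block of the
  feedback; the second is half a diagonal block of the inverse weight.\<close>

lemma scaled_gain_apply:
  assumes "finite J" "K \<subseteq> J" "p \<in> K"
  shows "(gain_mtx a \<odot>\<^bsub>K\<^esub> (trans_mtx Io_sum \<odot>\<^bsub>J\<^esub> gain_inv b)) p q =
      (if p = q then a (fst p) (snd p) / b (fst p) (snd p) else 0)"
    and "(gain_mtx a \<odot>\<^bsub>K\<^esub> (trans_mtx Io_sum \<odot>\<^bsub>J\<^esub> (gain_inv b \<odot>\<^bsub>J\<^esub> Io_sum))) p q =
      (if p = q then a (fst p) (snd p) / b (fst p) (snd p) else 0)"
  using assms finite_subset[OF assms(2,1)] subsetD[OF assms(2,3)]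
  by (simp_all add: gain_mtx_mul trans_Io_sum_mul gain_inv_def gain_mtx_apply Io_sum_apply divide_inverse)

lemma sum_Sigma_row:
  fixes f :: "'a \<times> nat \<Rightarrow> real"
  assumes "finite A" "\<And>i. finite (B i)" "i \<in> A"
  shows "(\<Sum>p\<in>Sigma A B. if fst p = i then f p else 0) = (\<Sum>k\<in>B i. f (i, k))"
proof -
  have "(\<Sum>p\<in>Sigma A B. if fst p = i then f p else 0) =
      (\<Sum>j\<in>A. \<Sum>k\<in>B j. if j = i then f (j, k) else 0)"
    using assms by (subst sum.Sigma) (auto simp: case_prod_beta intro!: sum.cong)
  also have "\<dots> = (\<Sum>j\<in>A. if j = i then (\<Sum>k\<in>B j. f (j, k)) else 0)"
    by (intro sum.cong) auto
  also have "\<dots> = (\<Sum>k\<in>B i. f (i, k))"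
    using assms by simp
  finally show ?thesis .
qed

text \<open>For diagonal \<open>S\<close> the equation for \<open>y\<close> decouples. Where
  \<open>s p = 0\<close> it forces \<open>u p = 0\<close> and leaves \<open>y p\<close> free, but
  \<open>y p\<close> is then multiplied by \<open>u p = 0\<close>, so the choice of \<open>y\<close>
  is harmless. The matching summand on the right is \<open>0 / 0 = 0\<close>.\<close>

lemma wnorm2_diagonal:
  assumes fin: "finite J" and S: "\<And>p q. p \<in> J \<Longrightarrow> q \<in> J \<Longrightarrow> S p q = (if p = q then s p else 0)"
  shows "wnorm2 J S u =
    (if \<forall>p\<in>J. s p = 0 \<longrightarrow> u p = 0 then ennreal (\<Sum>p\<in>J. (u p)\<^sup>2 / s p) else \<infinity>)"
proof -
  have Sy: "(S \<cdot>\<^bsub>J\<^esub> y) p = s p * y p" if "p \<in> J" for p y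
  proof -
    have "(S \<cdot>\<^bsub>J\<^esub> y) p = (\<Sum>q\<in>J. (if p = q then s p else 0) * y q)"
      unfolding mtx_vec_def using that by (intro sum.cong) (auto simp: S)
    then show ?thesis
      using sum_delta_mult(2)[OF fin, of p "\<lambda>_. s p" y] that by simp
  qed
  show ?thesis
  proof (cases "\<forall>p\<in>J. s p = 0 \<longrightarrow> u p = 0")
    case True
    let ?P = "\<lambda>y. \<forall>p\<in>J. (S \<cdot>\<^bsub>J\<^esub> y) p = u p"
    have ex: "?P (\<lambda>p. u p / s p)"
      using True by (auto simp: Sy)
    define Y where "Y = (SOME y. ?P y)"
    have "?P Y"
      unfolding Y_def using ex by (rule someI[of ?P])
    then have y: "s p * Y p = u p" if "p \<in> J" for p
      using Sy[OF that, of Y] that by simp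
    have "u p * Y p = (u p)\<^sup>2 / s p" if "p \<in> J" for p
    proof (cases "s p = 0")
      case True
      with y[OF that] show ?thesis by simp
    next
      case False
      then have "Y p = u p / s p"
        using y[OF that] by (simp add: eq_divide_eq mult.commute)
      then show ?thesis by (simp add: power2_eq_square)
    qed
    then have "scal_prod J u Y = (\<Sum>p\<in>J. (u p)\<^sup>2 / s p)"
      unfolding scal_prod_def by (intro sum.cong refl)
    then have "wnorm2 J S u = ennreal (\<Sum>p\<in>J. (u p)\<^sup>2 / s p)"
      unfolding wnorm2_def Y_def[symmetric] using exI[of ?P, OF ex] by (simp only: if_True)
    then show ?thesis
      by (subst if_P[OF True])
  next
    case False
    then have "\<not> (\<exists>y. \<forall>p\<in>J. (S \<cdot>\<^bsub>J\<^esub> y) p = u p)"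
      by (force simp: Sy)
    then show ?thesis
      unfolding wnorm2_def using False by auto
  qed
qed

lemma sum_from_2: "(\<Sum>k=1..n. if 2 \<le> k then f k else 0) = (\<Sum>k=2..n. f k)" for f :: "nat \<Rightarrow> real"
proof -
  have "{k \<in> {1..n}. 2 \<le> k} = {2..n}" by auto
  then show ?thesis by (simp add: sum.inter_filter[symmetric])
qed

subsection \<open>Integrated signals\<close>

text \<open>
  \<open>f\<close> is only absolutely continuous, so the fundamental theorem of calculus does not apply to \<open>f\<^sup>2\<close>.
  On a short interval the error is at most \<open>e\<close> times the integral of \<open>\<bar>g\<bar>\<close> by continuity of \<open>f\<close>, and both
  are additive in the interval.
\<close>

lemma square_balance_aux:
  fixes f g :: "real \<Rightarrow> real"
  assumes g: "g absolutely_integrable_on {0..T}"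
    and f: "\<And>t. t \<in> {0..T} \<Longrightarrow> (g has_integral (f t - f 0)) {0..t}"
    and cont: "continuous_on {0..T} f"
    and fg: "(\<lambda>t. f t * g t) integrable_on {0..T}"
    and T: "0 \<le> T" and e: "e > 0"
  shows "\<bar>(f T)\<^sup>2 - (f 0)\<^sup>2 - 2 * integral {0..T} (\<lambda>t. f t * g t)\<bar> \<le> e * integral {0..T} (\<lambda>t. \<bar>g t\<bar>)"
proof -
  have g_int: "g integrable_on {0..T}" and ag_int: "(\<lambda>t. \<bar>g t\<bar>) integrable_on {0..T}"
    using g by (auto simp: absolutely_integrable_on_def)
  define D where "D s t = (f t)\<^sup>2 - (f s)\<^sup>2 - 2 * integral {s..t} (\<lambda>t. f t * g t)" for s t
  \<comment> \<open>The premise \<open>0 \<le> s \<and> t \<le> T\<close> is built in because the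
    short intervals around an end point may stick out of \<open>{0..T}\<close>.\<close>
  define P where "P s t \<longleftrightarrow> (0 \<le> s \<and> t \<le> T \<longrightarrow> \<bar>D s t\<bar> \<le> e * integral {s..t} (\<lambda>t. \<bar>g t\<bar>))" for s t
  have sub: "h integrable_on {s..t}" if "h integrable_on {0..T}" "0 \<le> s" "t \<le> T" for h :: "real \<Rightarrow> real" and s t
    using that by (auto intro: integrable_on_subinterval)
  \<comment> \<open>Bisection: it suffices that \<open>P\<close> passes to unions of adjacent
    intervals and holds on all short intervals around each point.\<close>
  have "P 0 T"
  proof (rule Bolzano[OF T])
    fix a b c assume "P a b" "P b c" "a \<le> b" "b \<le> c"
    have split: "integral {a..b} h + integral {b..c} h = integral {a..c} h"
      if "h integrable_on {0..T}" "0 \<le> a" "c \<le> T" for h :: "real \<Rightarrow> real"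
      by (rule Henstock_Kurzweil_Integration.integral_combine[OF \<open>a \<le> b\<close> \<open>b \<le> c\<close> sub[OF that]])
    show "P a c"
      unfolding P_def
    proof (intro impI)
      assume ac: "0 \<le> a \<and> c \<le> T"
      then have 1: "\<bar>D a b\<bar> \<le> e * integral {a..b} (\<lambda>t. \<bar>g t\<bar>)" "\<bar>D b c\<bar> \<le> e * integral {b..c} (\<lambda>t. \<bar>g t\<bar>)"
        using \<open>P a b\<close> \<open>P b c\<close> \<open>a \<le> b\<close> \<open>b \<le> c\<close> by (auto simp: P_def)
      have "D a c = D a b + D b c"
        using split[OF fg] ac by (simp add: D_def)
      then have "\<bar>D a c\<bar> \<le> e * (integral {a..b} (\<lambda>t. \<bar>g t\<bar>) + integral {b..c} (\<lambda>t. \<bar>g t\<bar>))"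
        using 1 by (simp add: distrib_left)
      then show "\<bar>D a c\<bar> \<le> e * integral {a..c} (\<lambda>t. \<bar>g t\<bar>)"
        using split[OF ag_int] ac by simp
    qed
  next
    fix x assume x: "0 \<le> x" "x \<le> T"
    \<comment> \<open>The error factor is
      \<open>(f b - f x) + (f a - f x) - 2 * (f t - f x)\<close>, four differences counted with
      multiplicity, hence \<open>e / 4\<close>.\<close>
    obtain d where "d > 0" and d: "\<forall>y\<in>{0..T}. dist y x < d \<longrightarrow> dist (f y) (f x) < e / 4"
      using cont[unfolded continuous_on_iff, rule_format, of x "e / 4"] x e by auto
    show "\<exists>d>0. \<forall>a b. a \<le> x \<and> x \<le> b \<and> b - a < d \<longrightarrow> P a b"
    proof (intro exI conjI allI impI)
      fix a b assume ab: "a \<le> x \<and> x \<le> b \<and> b - a < d"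
      show "P a b"
        unfolding P_def
      proof (intro impI)
        assume ab': "0 \<le> a \<and> b \<le> T"
        have fb: "(g has_integral (f b - f a)) {a..b}"
        proof -
          have "integral {0..a} g + integral {a..b} g = integral {0..b} g"
            using ab ab' by (intro Henstock_Kurzweil_Integration.integral_combine sub[OF g_int]) auto
          moreover have "integral {0..a} g = f a - f 0" "integral {0..b} g = f b - f 0"
            using ab ab' by (auto intro!: integral_unique f)
          moreover have "g integrable_on {a..b}"
            using ab' by (intro sub[OF g_int]) auto
          ultimately show ?thesis
            by (simp add: has_integral_integrable_integral)
        qed
        \<comment> \<open>\<open>(f b)\<^sup>2 - (f a)\<^sup>2 = (f b + f a) * (f b - f a)\<close>,
          and the last factor is the integral of \<open>g\<close>.\<close>
        have 1: "((\<lambda>t. (f b + f a) * g t - 2 * (f t * g t)) has_integral D a b) {a..b}"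
        proof -
          have "(\<lambda>t. f t * g t) integrable_on {a..b}"
            using ab' by (intro sub[OF fg]) auto
          then have "((\<lambda>t. (f b + f a) * g t - 2 * (f t * g t)) has_integral
              (f b + f a) * (f b - f a) - 2 * integral {a..b} (\<lambda>t. f t * g t)) {a..b}"
            by (intro has_integral_diff has_integral_mult_right fb integrable_integral)
          then show ?thesis
            by (simp add: D_def power2_eq_square algebra_simps)
        qed
        have 2: "((\<lambda>t. e * \<bar>g t\<bar>) has_integral (e * integral {a..b} (\<lambda>t. \<bar>g t\<bar>))) {a..b}"
          using ab' by (intro has_integral_mult_right integrable_integral sub[OF ag_int]) auto
        have 3: "norm ((f b + f a) * g t - 2 * (f t * g t)) \<le> e * \<bar>g t\<bar>" if t: "t \<in> {a..b}" for t
        proof -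
          have near: "f y - f x < e / 4 \<and> f x - f y < e / 4" if "y \<in> {a..b}" for y
          proof -
            have "\<bar>f y - f x\<bar> < e / 4"
              using d[rule_format, of y] that ab ab' by (auto simp: dist_real_def)
            then show ?thesis by linarith
          qed
          have "\<bar>f b + f a - 2 * f t\<bar> \<le> e"
            using near[of a] near[of b] near[OF t] ab by (intro abs_leI) auto
          then have "\<bar>f b + f a - 2 * f t\<bar> * \<bar>g t\<bar> \<le> e * \<bar>g t\<bar>"
            by (rule mult_right_mono) simp
          then show ?thesis
            by (simp add: abs_mult[symmetric] algebra_simps)
        qed
        have "norm (D a b) \<le> e * integral {a..b} (\<lambda>t. \<bar>g t\<bar>)"
          using integral_norm_bound_integral[OF has_integral_integrable[OF 1] has_integral_integrable[OF 2] 3]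
          unfolding integral_unique[OF 1] integral_unique[OF 2] .
        then show "\<bar>D a b\<bar> \<le> e * integral {a..b} (\<lambda>t. \<bar>g t\<bar>)" by simp
      qed
    qed (fact \<open>d > 0\<close>)
  qed
  then show ?thesis
    using T by (simp add: P_def D_def)
qed

lemma continuous_times_absolutely_integrable:
  fixes f g :: "real \<Rightarrow> real"
  assumes "continuous_on {a..b} f" "g absolutely_integrable_on {a..b}"
  shows "(\<lambda>t. f t * g t) absolutely_integrable_on {a..b}"
proof -
  have "f \<in> borel_measurable (lebesgue_on {a..b})"
    using assms(1) by (intro continuous_imp_measurable_on_sets_lebesgue) auto
  moreover have "bounded (f ` {a..b})"
    using assms(1) by (intro compact_imp_bounded compact_continuous_image) auto
  ultimately show ?thesis
    using absolutely_integrable_bounded_measurable_product_real[of f "{a..b}" g] assms(2) by simp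
qed

lemma square_balance:
  fixes f g :: "real \<Rightarrow> real"
  assumes g: "g absolutely_integrable_on {0..T}"
    and f: "\<And>t. t \<in> {0..T} \<Longrightarrow> (g has_integral (f t - f 0)) {0..t}"
    and cont: "continuous_on {0..T} f"
    and T: "0 \<le> T"
  shows "((\<lambda>t. f t * g t) has_integral ((f T)\<^sup>2 / 2 - (f 0)\<^sup>2 / 2)) {0..T}"
proof -
  have fg: "(\<lambda>t. f t * g t) integrable_on {0..T}"
    using continuous_times_absolutely_integrable[OF cont g] by (simp add: absolutely_integrable_on_def)
  define c where "c = integral {0..T} (\<lambda>t. \<bar>g t\<bar>)"
  have c: "c \<ge> 0"
    using g by (auto simp: c_def absolutely_integrable_on_def intro!: integral_nonneg)
  have "\<bar>(f T)\<^sup>2 - (f 0)\<^sup>2 - 2 * integral {0..T} (\<lambda>t. f t * g t)\<bar> \<le> 0 + e" if "e > 0" for e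
  proof -
    \<comment> \<open>Dividing by \<open>c + 1\<close> instead of \<open>c\<close> covers the case
      \<open>c = 0\<close>.\<close>
    have "e / (c + 1) > 0"
      using that c by simp
    from square_balance_aux[OF g f cont fg T this]
    have "\<bar>(f T)\<^sup>2 - (f 0)\<^sup>2 - 2 * integral {0..T} (\<lambda>t. f t * g t)\<bar> \<le> e / (c + 1) * c"
      by (simp add: c_def)
    also have "\<dots> \<le> e"
      using that c by (simp add: field_simps)
    finally show ?thesis by simp
  qed
  then have "\<bar>(f T)\<^sup>2 - (f 0)\<^sup>2 - 2 * integral {0..T} (\<lambda>t. f t * g t)\<bar> \<le> 0"
    by (rule field_le_epsilon)
  then have "integral {0..T} (\<lambda>t. f t * g t) = (f T)\<^sup>2 / 2 - (f 0)\<^sup>2 / 2"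
    by simp
  then show ?thesis
    using integrable_integral[OF fg] by simp
qed

text \<open>Indefinite integrals are continuous on compact intervals. Continuity at \<open>t\<close>
  within the half-line is local, so the interval up to \<open>t + 1\<close> suffices.\<close>

lemma continuous_on_of_integral:
  fixes f g :: "real \<Rightarrow> real"
  assumes g: "\<And>t. 0 \<le> t \<Longrightarrow> (g has_integral (f t - c)) {0..t}"
  shows "f 0 = c" and "continuous_on {0..} f"
proof -
  show "f 0 = c"
    using has_integral_unique[OF has_integral_refl(2)[of g 0], of "f 0 - c"] g[of 0] by simp
  show "continuous_on {0..} f"
    unfolding continuous_on_eq_continuous_within
  proof
    fix t :: real assume t: "t \<in> {0..}"
    have "continuous_on {0..t+1} (\<lambda>t. c + integral {0..t} g)"
      using g[of "t + 1"] t by (intro continuous_intros indefinite_integral_continuous_1) auto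
    moreover have "c + integral {0..s} g = f s" if "s \<in> {0..t+1}" for s
      using integral_unique[OF g[of s]] that by simp
    ultimately have "continuous_on {0..t+1} f"
      by (rule continuous_on_eq)
    then have "continuous (at t within {0..t+1}) f"
      using t by (auto simp: continuous_on_eq_continuous_within)
    moreover have "at t within {0..t+1} = at t within {0..}"
      by (rule at_within_nhd[of t "{..<t+1}"]) auto
    ultimately show "continuous (at t within {0..}) f"
      by simp
  qed
qed

text \<open>The bridge between the gauge integral, in which trajectories and the energy balance are
  stated, and the Lebesgue integral of the cost.\<close>

lemma absolutely_integrable_on_iff_integrable:
  fixes f :: "real \<Rightarrow> real"
  shows "f absolutely_integrable_on {a..b} \<longleftrightarrow> integrable (lebesgue_on {a..b}) f"
  by (simp add: set_integrable_def integrable_restrict_space)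

lemma AE_lebesgue_on_subset:
  fixes P :: "real \<Rightarrow> bool"
  assumes "AE t in lebesgue_on A. P t" "B \<subseteq> A" "A \<in> sets lebesgue" "B \<in> sets lebesgue"
  shows "AE t in lebesgue_on B. P t"
  using assms by (auto simp: AE_restrict_space_iff elim!: eventually_mono)

lemma nn_integral_lebesgue_on_mono:
  fixes f :: "real \<Rightarrow> ennreal"
  assumes "B \<subseteq> A" "A \<in> sets lebesgue" "B \<in> sets lebesgue"
  shows "(\<integral>\<^sup>+t. f t \<partial>lebesgue_on B) \<le> (\<integral>\<^sup>+t. f t \<partial>lebesgue_on A)"
  using assms by (auto simp: nn_integral_restrict_space indicator_def intro!: nn_integral_mono)

text \<open>Add the tangent inequalities at \<open>s\<close> and at \<open>t\<close>.\<close>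

lemma deriv_monotone:
  assumes "admissible_obj f"
  shows "(s - t) * (deriv f s - deriv f t) \<ge> 0"
proof -
  have d: "(f has_field_derivative deriv f r) (at r)" for r
    using assms by (simp add: admissible_obj_def DERIV_deriv_iff_field_differentiable)
  have tangent: "f p - f q \<ge> deriv f q * (p - q)" for p q
    using assms d[of q] by (intro convex_on_imp_above_tangent[of UNIV]) (auto simp: admissible_obj_def)
  show ?thesis
    using tangent[of s t] tangent[of t s] by (simp add: algebra_simps)
qed

subsection \<open>The network as a passive system\<close>

text \<open>The collocated output: the transposed input matrix applied to
  \<open>b\<^sup>-\<^sup>1\<close> times the state. The block \<open>ones_sum\<close> times
  incidence, through which edge inputs reach the nodes, turns into \<open>omega\<close>.\<close>

definition port_output :: "('v, 'e) pd_system \<Rightarrow> ('v, 'e) state \<Rightarrow> ('v, 'e) input vct"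
  where "port_output S x = case_sum (case_sum (fst x) (omega S x)) (snd x)"

text \<open>The diagonal of \<open>R_inv S\<close>. It can vanish only at the edge inputs, where it
  is twice the feed-forward gain.\<close>

definition input_weight :: "('v, 'e) pd_system \<Rightarrow> ('v, 'e) input vct"
  where "input_weight S =
    case_sum (case_sum (\<lambda>(i, k). 2 * aV S i k / bV S i k) (\<lambda>j. 2 * dE S j))
      (\<lambda>(j, k). 2 * aE S j k / bE S j k)"

definition grad_gap :: "('v, 'e) pd_system \<Rightarrow> ('v, 'e) state \<Rightarrow> ('v, 'e) state \<Rightarrow> real"
  where "grad_gap S x y = (\<Sum>i\<in>nodes S.
    (theta S x i - theta S y i) * (grad_obj S (theta S x) i - grad_obj S (theta S y) i))"

definition energy :: "('v, 'e) pd_system \<Rightarrow> ('v, 'e) state \<Rightarrow> ('v, 'e) state \<Rightarrow> real"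
  where "energy S x y =
    (\<Sum>(i, k)\<in>XV S. (fst x (i, k) - fst y (i, k))\<^sup>2 / 2 / bV S i k)
    + (\<Sum>(j, k)\<in>XE S. (snd x (j, k) - snd y (j, k))\<^sup>2 / 2 / bE S j k)"

text \<open>The rate of change of \<open>energy S x y\<close> when \<open>x\<close> and
  \<open>y\<close> are driven by \<open>u\<close> and \<open>v\<close>, expressed without the state
  equations.\<close>

definition power_flow ::
    "('v, 'e) pd_system \<Rightarrow> ('v, 'e) state \<Rightarrow> ('v, 'e) state \<Rightarrow> ('v, 'e) input vct \<Rightarrow> ('v, 'e) input vct \<Rightarrow> real"
  where "power_flow S x y u v =
    (\<Sum>p\<in>UX S. (port_output S x p - port_output S y p) * (u p - v p)) - grad_gap S x y"

definition continuous_states :: "('v, 'e) pd_system \<Rightarrow> real set \<Rightarrow> (real \<Rightarrow> ('v, 'e) state) \<Rightarrow> bool"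
  where "continuous_states S A x \<longleftrightarrow>
    (\<forall>p\<in>XV S. continuous_on A (\<lambda>t. fst (x t) p)) \<and> (\<forall>p\<in>XE S. continuous_on A (\<lambda>t. snd (x t) p))"

text \<open>By \<open>wnorm2_diagonal\<close>, exactly the inputs of finite weighted norm.\<close>

definition admissible_input :: "('v, 'e) pd_system \<Rightarrow> ('v, 'e) input vct \<Rightarrow> bool"
  where "admissible_input S u \<longleftrightarrow> (\<forall>p\<in>UX S. input_weight S p = 0 \<longrightarrow> u p = 0)"

text \<open>
  The next two sums are the intended ones for admissible inputs only, which vanish wherever
  \<open>input_weight\<close> does: such terms are \<open>0 / 0 = 0\<close>.
\<close>

definition running_cost ::
    "('v, 'e) pd_system \<Rightarrow> ('v, 'e) state \<Rightarrow> ('v, 'e) state \<Rightarrow> ('v, 'e) input vct \<Rightarrow> real"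
  where "running_cost S xe x u = (\<Sum>p\<in>UX S. (u p)\<^sup>2 / input_weight S p)
    + ((\<Sum>p\<in>UX S. input_weight S p / 4 * (port_output S x p)\<^sup>2) + grad_gap S x xe)"

definition excess_cost :: "('v, 'e) pd_system \<Rightarrow> ('v, 'e) state \<Rightarrow> ('v, 'e) input vct \<Rightarrow> real"
  where "excess_cost S x u =
    (\<Sum>p\<in>UX S. (u p + input_weight S p / 2 * port_output S x p)\<^sup>2 / input_weight S p)"

lemma omega_eq: "omega S x j = (\<Sum>i\<in>nodes S. incidence S i j * theta S x i)"
  by (simp add: omega_def mtx_vec_def trans_mtx_def)

lemma phi_tilde_eq:
  "phi_tilde S x i = - grad_obj S (theta S x) i - (\<Sum>j\<in>edges S. incidence S i j * mu_tilde S x j)"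
  by (simp add: phi_tilde_def mtx_vec_def)

context
  fixes S :: "('v, 'e) pd_system"
  assumes setting: "pd_setting S"
begin

lemma finite_nodes [simp]: "finite (nodes S)"
  and finite_edges [simp]: "finite (edges S)"
  using setting by (auto simp: pd_setting_def dest: fin_digraph.finite_verts fin_digraph.finite_arcs)

lemma finite_index_sets: "finite (XV S)" "finite (XE S)" "finite (KV S)" "finite (KE S)" "finite (UX S)"
  by auto

lemma gains_pos:
  "i \<in> nodes S \<Longrightarrow> k \<in> {1..rhoV S i} \<Longrightarrow> bV S i k > 0"
  "i \<in> nodes S \<Longrightarrow> k \<in> {2..rhoV S i} \<Longrightarrow> aV S i k > 0"
  "j \<in> edges S \<Longrightarrow> k \<in> {1..rhoE S j} \<Longrightarrow> bE S j k > 0"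
  "j \<in> edges S \<Longrightarrow> k \<in> {2..rhoE S j} \<Longrightarrow> aE S j k > 0"
  "j \<in> edges S \<Longrightarrow> dE S j \<ge> 0"
  using setting by (auto simp: pd_setting_def admissible_gains_def)

lemma input_weight_nonneg: "p \<in> UX S \<Longrightarrow> input_weight S p \<ge> 0"
  by (auto simp: input_weight_def intro!: divide_nonneg_pos gains_pos less_imp_le[OF gains_pos(2)] less_imp_le[OF gains_pos(4)])

lemma theta_eq: "i \<in> nodes S \<Longrightarrow> theta S x i = (\<Sum>k=1..rhoV S i. fst x (i, k))"
  using sum_Sigma_row[of "nodes S" "\<lambda>i. {1..rhoV S i}" i "fst x"]
  by (simp add: theta_def mtx_vec_def trans_mtx_def ones_sum_apply if_distrib[of "\<lambda>z. z * _"] cong: if_cong)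

lemma mu_tilde_eq: "j \<in> edges S \<Longrightarrow> mu_tilde S x j = (\<Sum>k=1..rhoE S j. snd x (j, k))"
  using sum_Sigma_row[of "edges S" "\<lambda>j. {1..rhoE S j}" j "snd x"]
  by (simp add: mu_tilde_def mtx_vec_def trans_mtx_def ones_sum_apply if_distrib[of "\<lambda>z. z * _"] cong: if_cong)

section \<open>The system matrices in coordinates\<close>

lemma sum_nodes_single:
  "i \<in> nodes S \<Longrightarrow> (\<Sum>l\<in>nodes S. (if i = l then b else 0) * f l) = (b :: real) * f i"
  using sum_delta_mult(2)[OF finite_nodes, of i "\<lambda>_. b" f] by simp

text \<open>The condition \<open>2 \<le> k\<close> reflects the zero first row of \<open>Io\<close>:
  the first component of a node has no input of its own, while edge inputs act on all its components
  alike.\<close>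

lemma rhsV_eq:
  assumes "(i, k) \<in> XV S"
  shows "rhsV S x u (i, k) = bV S i k * (phi_tilde S x i
    + (if 2 \<le> k then u (Inl (Inl (i, k))) else 0) + (\<Sum>j\<in>edges S. incidence S i j * u (Inl (Inr j))))"
proof -
  note gain = gain_mtx_mul[OF finite_index_sets(1) assms]
  have A: "(ones_sum \<odot>\<^bsub>nodes S\<^esub> incidence S) (i, k) j = incidence S i j" for j
    using assms sum_nodes_single[of i 1 "\<lambda>l. incidence S l j"]
    by (simp add: mtx_mul_def ones_sum_apply)
  have one: "((gain_mtx (bV S) \<odot>\<^bsub>XV S\<^esub> ones_sum) \<cdot>\<^bsub>nodes S\<^esub> phi_tilde S x) (i, k) = bV S i k * phi_tilde S x i"
    using assms sum_nodes_single[of i "bV S i k" "phi_tilde S x"]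
    by (simp only: mtx_vec_def gain) (simp add: ones_sum_apply if_distrib[of "\<lambda>z. _ * z"] cong: if_cong)
  have "(b_uV S \<cdot>\<^bsub>UV S\<^esub> (\<lambda>q. u (Inl q))) (i, k) =
      (\<Sum>q\<in>KV S. (if (i, k) = q then bV S i k else 0) * u (Inl (Inl q)))
      + (\<Sum>j\<in>edges S. bV S i k * incidence S i j * u (Inl (Inr j)))"
    by (simp only: mtx_vec_def b_uV_def gain) (simp add: sum.Plus hcat_def A Io_sum_apply if_distrib[of "\<lambda>z. _ * z"] cong: if_cong)
  also have "(\<Sum>q\<in>KV S. (if (i, k) = q then bV S i k else 0) * u (Inl (Inl q))) =
      (if 2 \<le> k then bV S i k * u (Inl (Inl (i, k))) else 0)"
    using assms sum_delta_mult(2)[OF finite_index_sets(3), of "(i,k)" "\<lambda>_. bV S i k" "\<lambda>q. u (Inl (Inl q))"] by simp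
  finally show ?thesis
    unfolding rhsV_def one by (auto simp: algebra_simps sum_distrib_left)
qed

lemma rhsE_eq:
  assumes "(j, k) \<in> XE S"
  shows "rhsE S x u (j, k) = bE S j k * (omega S x j + (if 2 \<le> k then u (Inr (j, k)) else 0))"
proof -
  note gain = gain_mtx_mul[OF finite_index_sets(2) assms]
  have one: "((gain_mtx (bE S) \<odot>\<^bsub>XE S\<^esub> ones_sum) \<cdot>\<^bsub>edges S\<^esub> omega S x) (j, k) = bE S j k * omega S x j"
    using assms sum_delta_mult(2)[OF finite_edges, of j "\<lambda>_. bE S j k" "omega S x"]
    by (simp only: mtx_vec_def gain) (simp add: ones_sum_apply if_distrib[of "\<lambda>z. _ * z"] cong: if_cong)
  have "(b_uE S \<cdot>\<^bsub>KE S\<^esub> (\<lambda>q. u (Inr q))) (j, k) =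
      (\<Sum>q\<in>KE S. (if (j, k) = q then bE S j k else 0) * u (Inr q))"
    by (simp only: mtx_vec_def b_uE_def gain) (simp add: Io_sum_apply if_distrib[of "\<lambda>z. _ * z"] cong: if_cong)
  also have "\<dots> = (if 2 \<le> k then bE S j k * u (Inr (j, k)) else 0)"
    using assms sum_delta_mult(2)[OF finite_index_sets(4), of "(j,k)" "\<lambda>_. bE S j k" "\<lambda>q. u (Inr q)"] by simp
  finally show ?thesis
    unfolding rhsE_def one by (auto simp: algebra_simps)
qed

lemma KV_subset: "KV S \<subseteq> XV S" and KE_subset: "KE S \<subseteq> XE S"
  by auto

lemma R_inv_eq:
  assumes "p \<in> UX S" "q \<in> UX S"
  shows "R_inv S p q = (if p = q then input_weight S p else 0)"
proof -
  note gain = scaled_gain_apply(2)[OF finite_index_sets(1) KV_subset] scaled_gain_apply(2)[OF finite_index_sets(2) KE_subset]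
  consider (V) i k where "p = Inl (Inl (i, k))" "(i, k) \<in> KV S" | (D) j where "p = Inl (Inr j)" "j \<in> edges S"
    | (E) j k where "p = Inr (j, k)" "(j, k) \<in> KE S"
    using assms by auto
  then show ?thesis
  proof cases
    case V
    show ?thesis
      unfolding R_inv_def RV_inv_def RE_inv_def blockdiag_def vcat_def hcat_def mtx_scale_def V(1)
        input_weight_def sum.case gain(1)[OF V(2)]
      by (auto split: sum.splits)
  next
    case D
    show ?thesis
      unfolding R_inv_def RV_inv_def RE_inv_def blockdiag_def vcat_def hcat_def mtx_scale_def D(1)
        input_weight_def sum.case diag_mtx_def
      by (auto split: sum.splits)
  next
    case E
    show ?thesis
      unfolding R_inv_def RV_inv_def RE_inv_def blockdiag_def vcat_def hcat_def mtx_scale_def E(1)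
        input_weight_def sum.case gain(2)[OF E(2)]
      by (auto split: sum.splits)
  qed
qed

text \<open>All three blocks of the feedback are diagonal in the port output. The value is the
  minimizer of \<open>u\<^sup>2 / s + z * u\<close> over \<open>u\<close> when \<open>s > 0\<close>,
  which is why the excess cost vanishes along the feedback.\<close>

lemma U_fb_eq:
  assumes "p \<in> UX S"
  shows "U_fb S x p = - (input_weight S p / 2 * port_output S x p)"
proof -
  note gain = scaled_gain_apply(1)[OF finite_index_sets(1) KV_subset] scaled_gain_apply(1)[OF finite_index_sets(2) KE_subset]
  have gainD: "(\<Sum>p\<in>XV S. (diag_mtx (dE S) \<odot>\<^bsub>edges S\<^esub> (trans_mtx (incidence S) \<odot>\<^bsub>nodes S\<^esub> trans_mtx ones_sum)) j p * fst x p)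
      = dE S j * omega S x j" if "j \<in> edges S" for j
  proof -
    have "(diag_mtx (dE S) \<odot>\<^bsub>edges S\<^esub> (trans_mtx (incidence S) \<odot>\<^bsub>nodes S\<^esub> trans_mtx ones_sum)) j p
        = dE S j * (\<Sum>i\<in>nodes S. incidence S i j * ones_sum p i)" for p
      using that sum_delta_mult(2)[OF finite_edges, of j "\<lambda>_. dE S j"
        "\<lambda>l. \<Sum>i\<in>nodes S. incidence S i l * ones_sum p i"]
      by (simp add: mtx_mul_def diag_mtx_def trans_mtx_def)
    then have "(\<Sum>p\<in>XV S. (diag_mtx (dE S) \<odot>\<^bsub>edges S\<^esub> (trans_mtx (incidence S) \<odot>\<^bsub>nodes S\<^esub> trans_mtx ones_sum)) j p * fst x p)
      = dE S j * (\<Sum>p\<in>XV S. \<Sum>i\<in>nodes S. incidence S i j * ones_sum p i * fst x p)"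
      by (simp add: sum_distrib_left sum_distrib_right mult.assoc)
    also have "\<dots> = dE S j * omega S x j"
      by (subst sum.swap) (simp add: omega_def theta_def mtx_vec_def trans_mtx_def sum_distrib_left mult.assoc)
    finally show ?thesis .
  qed
  consider (V) i k where "p = Inl (Inl (i, k))" "(i, k) \<in> KV S" | (D) j where "p = Inl (Inr j)" "j \<in> edges S"
    | (E) j k where "p = Inr (j, k)" "(j, k) \<in> KE S"
    using assms by auto
  then show ?thesis
  proof cases
    case V
    have "(i, k) \<in> XV S" using V by auto
    then have "(\<Sum>q\<in>XV S. (if (i, k) = q then aV S i k / bV S i k else 0) * fst x q) = aV S i k / bV S i k * fst x (i, k)"
      by (subst sum_delta_mult(2)[OF finite_index_sets(1)]) (rule if_P)
    then show ?thesis
      unfolding V(1) U_fb_def uV_fb_def mtx_vec_def vcat_def sum.case gain(1)[OF V(2)] fst_conv snd_conv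
      by (simp add: input_weight_def port_output_def)
  next
    case D
    show ?thesis
      unfolding D(1) U_fb_def uV_fb_def mtx_vec_def vcat_def sum.case gainD[OF D(2)]
      by (simp add: input_weight_def port_output_def)
  next
    case E
    have "(j, k) \<in> XE S" using E by auto
    then have "(\<Sum>q\<in>XE S. (if (j, k) = q then aE S j k / bE S j k else 0) * snd x q) = aE S j k / bE S j k * snd x (j, k)"
      by (subst sum_delta_mult(2)[OF finite_index_sets(2)]) (rule if_P)
    then show ?thesis
      unfolding E(1) U_fb_def uE_fb_def mtx_vec_def sum.case gain(2)[OF E(2)] fst_conv snd_conv
      by (simp add: input_weight_def port_output_def)
  qed
qed

section \<open>Power balance and state cost in port variables\<close>

lemmas fin = finite_nodes finite_edges finite_index_sets

lemma sum_UX: "(\<Sum>p\<in>UX S. f p) =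
    (\<Sum>p\<in>KV S. f (Inl (Inl p))) + (\<Sum>j\<in>edges S. f (Inl (Inr j))) + (\<Sum>p\<in>KE S. f (Inr p))"
  for f :: "_ \<Rightarrow> real"
  using fin by (simp add: sum.Plus)

lemma sum_XV_row: "(\<Sum>(i, k)\<in>XV S. f i k) = (\<Sum>i\<in>nodes S. \<Sum>k=1..rhoV S i. f i k)"
  and sum_XE_row: "(\<Sum>(j, k)\<in>XE S. g j k) = (\<Sum>j\<in>edges S. \<Sum>k=1..rhoE S j. g j k)"
  and sum_KV_row: "(\<Sum>(i, k)\<in>KV S. f i k) = (\<Sum>i\<in>nodes S. \<Sum>k=2..rhoV S i. f i k)"
  and sum_KE_row: "(\<Sum>(j, k)\<in>KE S. g j k) = (\<Sum>j\<in>edges S. \<Sum>k=2..rhoE S j. g j k)"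
  for f g :: "_ \<Rightarrow> nat \<Rightarrow> real"
  by (subst sum.Sigma; use fin in auto)+

text \<open>Division by the gains leaves, at each node, a rate common to all components apart from
  their own inputs, so summing over the components turns state differences into differences of
  \<open>theta\<close> and \<open>mu_tilde\<close>. The coupling is skew: the nodes contribute
  \<open>- w j * m j\<close> and the edges \<open>m j * w j\<close>. By the same transposition, edge
  inputs are paired with \<open>omega\<close>.\<close>

lemma power_balance:
  "(\<Sum>(i, k)\<in>XV S. (fst x (i, k) - fst y (i, k)) * (rhsV S x u (i, k) - rhsV S y v (i, k)) / bV S i k)
   + (\<Sum>(j, k)\<in>XE S. (snd x (j, k) - snd y (j, k)) * (rhsE S x u (j, k) - rhsE S y v (j, k)) / bE S j k)
   = (\<Sum>p\<in>UX S. (port_output S x p - port_output S y p) * (u p - v p)) - grad_gap S x y"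
  (is "?V + ?E = _")
proof -
  define du where "du p = u p - v p" for p
  define w where "w j = omega S x j - omega S y j" for j
  define m where "m j = mu_tilde S x j - mu_tilde S y j" for j
  define h where "h i = theta S x i - theta S y i" for i
  define g where "g i = grad_obj S (theta S x) i - grad_obj S (theta S y) i" for i
  have w: "w j = (\<Sum>i\<in>nodes S. incidence S i j * h i)" for j
    by (simp add: w_def h_def omega_eq sum_subtractf right_diff_distrib)
  have phi: "phi_tilde S x i - phi_tilde S y i = - g i - (\<Sum>j\<in>edges S. incidence S i j * m j)" for i
    by (simp add: phi_tilde_eq g_def m_def sum_subtractf right_diff_distrib)
  have "?V = (\<Sum>i\<in>nodes S. \<Sum>k=1..rhoV S i. (fst x (i, k) - fst y (i, k)) * (- g i - (\<Sum>j\<in>edges S. incidence S i j * m j)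
      + (\<Sum>j\<in>edges S. incidence S i j * du (Inl (Inr j))))
      + (if 2 \<le> k then (fst x (i, k) - fst y (i, k)) * du (Inl (Inl (i, k))) else 0))"
  proof (subst sum_XV_row, intro sum.cong refl)
    fix i k assume "i \<in> nodes S" "k \<in> {1..rhoV S i}"
    then have ik: "(i, k) \<in> XV S" by auto
    have b: "bV S i k \<noteq> 0" using gains_pos(1)[of i k] ik by auto
    have eq: "rhsV S x u (i, k) - rhsV S y v (i, k) = bV S i k * ((phi_tilde S x i - phi_tilde S y i)
      + (if 2 \<le> k then du (Inl (Inl (i, k))) else 0) + (\<Sum>j\<in>edges S. incidence S i j * du (Inl (Inr j))))"
      unfolding rhsV_eq[OF ik] du_def
      by (simp add: algebra_simps sum_subtractf)
    show "(fst x (i, k) - fst y (i, k)) * (rhsV S x u (i, k) - rhsV S y v (i, k)) / bV S i k = 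
       (fst x (i, k) - fst y (i, k)) * (- g i - (\<Sum>j\<in>edges S. incidence S i j * m j)
      + (\<Sum>j\<in>edges S. incidence S i j * du (Inl (Inr j))))
      + (if 2 \<le> k then (fst x (i, k) - fst y (i, k)) * du (Inl (Inl (i, k))) else 0)"
      unfolding eq mult.left_commute[of _ "bV S i k"] nonzero_mult_div_cancel_left[OF b] phi
      by (simp add: algebra_simps)
  qed
  also have "\<dots> = (\<Sum>i\<in>nodes S. h i * (- g i - (\<Sum>j\<in>edges S. incidence S i j * m j)
      + (\<Sum>j\<in>edges S. incidence S i j * du (Inl (Inr j))))) 
      + (\<Sum>(i, k)\<in>KV S. (fst x (i, k) - fst y (i, k)) * du (Inl (Inl (i, k))))"
    unfolding sum.distrib sum_from_2 sum_KV_row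
    by (simp add: sum_distrib_right[symmetric] h_def theta_eq sum_subtractf)
  also have "(\<Sum>i\<in>nodes S. h i * (- g i - (\<Sum>j\<in>edges S. incidence S i j * m j)
      + (\<Sum>j\<in>edges S. incidence S i j * du (Inl (Inr j))))) =
      - grad_gap S x y + (\<Sum>i\<in>nodes S. \<Sum>j\<in>edges S. incidence S i j * h i * (du (Inl (Inr j)) - m j))"
    by (simp add: grad_gap_def h_def[symmetric] g_def[symmetric] algebra_simps sum.distrib sum_subtractf sum_distrib_left sum_negf)
  \<comment> \<open>Exchanging the sums moves the incidence matrix onto \<open>h\<close>, which
    turns it into \<open>w\<close>.\<close>
  also have "(\<Sum>i\<in>nodes S. \<Sum>j\<in>edges S. incidence S i j * h i * (du (Inl (Inr j)) - m j)) =
      (\<Sum>j\<in>edges S. w j * (du (Inl (Inr j)) - m j))"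
    by (subst sum.swap) (simp add: w sum_distrib_right)
  finally have V: "?V = - grad_gap S x y + (\<Sum>j\<in>edges S. w j * (du (Inl (Inr j)) - m j))
      + (\<Sum>(i, k)\<in>KV S. (fst x (i, k) - fst y (i, k)) * du (Inl (Inl (i, k))))" .
  have "?E = (\<Sum>j\<in>edges S. \<Sum>k=1..rhoE S j. (snd x (j, k) - snd y (j, k)) * w j
      + (if 2 \<le> k then (snd x (j, k) - snd y (j, k)) * du (Inr (j, k)) else 0))"
  proof (subst sum_XE_row, intro sum.cong refl)
    fix j k assume "j \<in> edges S" "k \<in> {1..rhoE S j}"
    then have jk: "(j, k) \<in> XE S" by auto
    have b: "bE S j k \<noteq> 0" using gains_pos(3)[of j k] jk by auto
    show "(snd x (j, k) - snd y (j, k)) * (rhsE S x u (j, k) - rhsE S y v (j, k)) / bE S j k = 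
       (snd x (j, k) - snd y (j, k)) * w j
      + (if 2 \<le> k then (snd x (j, k) - snd y (j, k)) * du (Inr (j, k)) else 0)"
      unfolding rhsE_eq[OF jk] du_def w_def
      using b by (simp add: divide_simps) (simp add: algebra_simps)
  qed
  also have "\<dots> = (\<Sum>j\<in>edges S. m j * w j) + (\<Sum>(j, k)\<in>KE S. (snd x (j, k) - snd y (j, k)) * du (Inr (j, k)))"
    unfolding sum.distrib sum_from_2 sum_KE_row
    by (simp add: sum_distrib_right[symmetric] m_def mu_tilde_eq sum_subtractf)
  finally have E: "?E = (\<Sum>j\<in>edges S. m j * w j) + (\<Sum>(j, k)\<in>KE S. (snd x (j, k) - snd y (j, k)) * du (Inr (j, k)))" .
  \<comment> \<open>The products of \<open>w\<close> and \<open>m\<close> in \<open>V\<close> and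
    \<open>E\<close> cancel.\<close>
  show ?thesis
    unfolding V E sum_UX
    by (simp add: port_output_def w_def[symmetric] du_def[symmetric] case_prod_unfold algebra_simps sum_subtractf)
qed

lemma grad_gap_nonneg: "grad_gap S x y \<ge> 0"
  using setting unfolding grad_gap_def grad_obj_def
  by (intro sum_nonneg deriv_monotone) (auto simp: pd_setting_def)

lemma energy_nonneg: "energy S x y \<ge> 0"
  unfolding energy_def using gains_pos
  by (intro add_nonneg_nonneg sum_nonneg) (auto intro!: divide_nonneg_pos)

text \<open>The Laplacian form is the sum of \<open>dE S j * (omega S x j)\<^sup>2\<close>. Since
  \<open>input_weight\<close> contains the factor 2, a quarter of it gives both the coefficients
  \<open>a / (2 * b)\<close> and the factor 1/2 of the Laplacian term. The state \<open>y\<close>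
  only has to realize \<open>\<theta>s\<close>, which makes the gradient terms a
  \<open>grad_gap\<close>.\<close>

lemma state_cost_eq:
  assumes "\<And>i. i \<in> nodes S \<Longrightarrow> theta S y i = \<theta>s i"
  shows "qV S \<theta>s x + qE S x = (\<Sum>p\<in>UX S. input_weight S p / 4 * (port_output S x p)\<^sup>2) + grad_gap S x y"
proof -
  have "scal_prod (nodes S) (theta S x) (lap S \<cdot>\<^bsub>nodes S\<^esub> theta S x) =
      (\<Sum>i\<in>nodes S. \<Sum>l\<in>nodes S. \<Sum>j\<in>edges S. theta S x i * (incidence S i j * (dE S j * incidence S l j)) * theta S x l)"
    by (simp add: scal_prod_def mtx_vec_def lap_def mtx_mul_def diag_mtx_def trans_mtx_def sum_distrib_left sum_distrib_right
        sum_delta_mult(2) fin mult.assoc)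
  also have "\<dots> = (\<Sum>j\<in>edges S. \<Sum>i\<in>nodes S. \<Sum>l\<in>nodes S. theta S x i * (incidence S i j * (dE S j * incidence S l j)) * theta S x l)"
    by (subst sum.swap[of _ "nodes S" "edges S"], subst sum.swap[of _ "edges S" "nodes S"]) simp
  also have "\<dots> = (\<Sum>j\<in>edges S. dE S j * (omega S x j)\<^sup>2)"
    by (simp add: omega_eq power2_eq_square sum_product sum_distrib_left mult_ac)
  finally have lap: "scal_prod (nodes S) (theta S x) (lap S \<cdot>\<^bsub>nodes S\<^esub> theta S x) = \<dots>" .
  have gap: "(\<Sum>i\<in>nodes S. (theta S x i - \<theta>s i) * (deriv (obj S i) (theta S x i) - deriv (obj S i) (\<theta>s i))) = grad_gap S x y"
    unfolding grad_gap_def grad_obj_def using assms by (intro sum.cong) auto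
  show ?thesis
    unfolding qV_def qE_def lap sum.distrib gap sum_UX
    by (simp add: input_weight_def port_output_def case_prod_unfold sum_KV_row[symmetric, unfolded case_prod_unfold]
       sum_KE_row[symmetric, unfolded case_prod_unfold] sum_distrib_left mult_ac)
qed

subsection \<open>Trajectories and the energy balance\<close>

lemma trajectoryD:
  assumes "trajectory S x0 u x" "0 \<le> t"
  shows "p \<in> XV S \<Longrightarrow> ((\<lambda>s. rhsV S (x s) (u s) p) has_integral (fst (x t) p - fst x0 p)) {0..t}"
    and "q \<in> XE S \<Longrightarrow> ((\<lambda>s. rhsE S (x s) (u s) q) has_integral (snd (x t) q - snd x0 q)) {0..t}"
  using assms unfolding trajectory_def by blast+

lemma trajectory_initial:
  assumes "trajectory S x0 u x"
  shows "p \<in> XV S \<Longrightarrow> fst (x 0) p = fst x0 p" "q \<in> XE S \<Longrightarrow> snd (x 0) q = snd x0 q"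
  by (rule continuous_on_of_integral(1)[OF trajectoryD(1)[OF assms]]; simp)
    (rule continuous_on_of_integral(1)[OF trajectoryD(2)[OF assms]]; simp)

lemma trajectory_continuous:
  assumes "trajectory S x0 u x"
  shows "continuous_states S {0..} x"
  unfolding continuous_states_def
  by (intro conjI ballI continuous_on_of_integral(2)[OF trajectoryD(1)[OF assms]]
      continuous_on_of_integral(2)[OF trajectoryD(2)[OF assms]])

lemma continuous_states_subset: "continuous_states S A x \<Longrightarrow> B \<subseteq> A \<Longrightarrow> continuous_states S B x"
  unfolding continuous_states_def by (blast intro: continuous_on_subset)

lemma continuous_theta:
  "continuous_states S A x \<Longrightarrow> i \<in> nodes S \<Longrightarrow> continuous_on A (\<lambda>t. theta S (x t) i)"
  by (auto simp: theta_eq continuous_states_def intro!: continuous_intros)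

lemma continuous_mu_tilde:
  "continuous_states S A x \<Longrightarrow> j \<in> edges S \<Longrightarrow> continuous_on A (\<lambda>t. mu_tilde S (x t) j)"
  by (auto simp: mu_tilde_eq continuous_states_def intro!: continuous_intros)

lemma continuous_omega: "continuous_states S A x \<Longrightarrow> continuous_on A (\<lambda>t. omega S (x t) j)"
  by (auto simp: omega_eq intro!: continuous_intros continuous_theta)

lemma continuous_grad_obj:
  assumes "continuous_states S A x" "i \<in> nodes S"
  shows "continuous_on A (\<lambda>t. grad_obj S (theta S (x t)) i)"
proof -
  have "continuous_on UNIV (deriv (obj S i))"
    using setting assms(2) by (simp add: pd_setting_def admissible_obj_def)
  then show ?thesis
    unfolding grad_obj_def using continuous_theta[OF assms] by (rule continuous_on_compose2) auto
qed

lemma continuous_phi_tilde: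
  "continuous_states S A x \<Longrightarrow> i \<in> nodes S \<Longrightarrow> continuous_on A (\<lambda>t. phi_tilde S (x t) i)"
  by (auto simp: phi_tilde_eq intro!: continuous_intros continuous_grad_obj continuous_mu_tilde)

lemma continuous_port_output:
  assumes "continuous_states S A x" "p \<in> UX S"
  shows "continuous_on A (\<lambda>t. port_output S (x t) p)"
  using assms continuous_omega[OF assms(1)]
  by (auto simp: port_output_def continuous_states_def)

lemma continuous_grad_gap:
  "continuous_states S A x \<Longrightarrow> continuous_states S A y \<Longrightarrow> continuous_on A (\<lambda>t. grad_gap S (x t) (y t))"
  unfolding grad_gap_def by (intro continuous_intros continuous_theta continuous_grad_obj)

lemma rhs_absolutely_integrable:
  assumes x: "continuous_states S {0..T} x"
    and u: "\<And>p. p \<in> UX S \<Longrightarrow> (\<lambda>t. u t p) absolutely_integrable_on {0..T}"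
  shows "p \<in> XV S \<Longrightarrow> (\<lambda>t. rhsV S (x t) (u t) p) absolutely_integrable_on {0..T}"
    and "q \<in> XE S \<Longrightarrow> (\<lambda>t. rhsE S (x t) (u t) q) absolutely_integrable_on {0..T}"
proof -
  assume p: "p \<in> XV S"
  obtain i k where ik: "p = (i, k)" by force
  have "(\<lambda>t. if 2 \<le> k then u t (Inl (Inl (i, k))) else 0) absolutely_integrable_on {0..T}"
    using p by (cases "2 \<le> k") (auto simp: ik intro!: u)
  moreover have "(\<lambda>t. \<Sum>j\<in>edges S. incidence S i j * u t (Inl (Inr j))) absolutely_integrable_on {0..T}"
    by (intro absolutely_integrable_sum fin set_integrable_mult_right u) auto
  moreover have "(\<lambda>t. phi_tilde S (x t) i) absolutely_integrable_on {0..T}"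
    using p by (intro absolutely_integrable_continuous_real continuous_phi_tilde x) (auto simp: ik)
  ultimately show "(\<lambda>t. rhsV S (x t) (u t) p) absolutely_integrable_on {0..T}"
    unfolding ik rhsV_eq[OF p[unfolded ik]]
    by (intro set_integrable_mult_right set_integral_add)
next
  assume q: "q \<in> XE S"
  obtain j k where jk: "q = (j, k)" by force
  have "(\<lambda>t. if 2 \<le> k then u t (Inr (j, k)) else 0) absolutely_integrable_on {0..T}"
    using q by (cases "2 \<le> k") (auto simp: jk intro!: u)
  moreover have "(\<lambda>t. omega S (x t) j) absolutely_integrable_on {0..T}"
    by (intro absolutely_integrable_continuous_real continuous_omega x)
  ultimately show "(\<lambda>t. rhsE S (x t) (u t) q) absolutely_integrable_on {0..T}"
    unfolding jk rhsE_eq[OF q[unfolded jk]]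
    by (intro set_integrable_mult_right set_integral_add)
qed

lemma power_flow_absolutely_integrable:
  assumes x: "continuous_states S {0..T} x" and y: "continuous_states S {0..T} y"
    and u: "\<And>p. p \<in> UX S \<Longrightarrow> (\<lambda>t. u t p) absolutely_integrable_on {0..T}"
    and v: "\<And>p. p \<in> UX S \<Longrightarrow> (\<lambda>t. v t p) absolutely_integrable_on {0..T}"
  shows "(\<lambda>t. power_flow S (x t) (y t) (u t) (v t)) absolutely_integrable_on {0..T}"
  unfolding power_flow_def
  by (intro set_integral_diff absolutely_integrable_sum fin continuous_times_absolutely_integrable
      continuous_on_diff continuous_port_output x y u v absolutely_integrable_continuous_real continuous_grad_gap)

text \<open>\<open>square_balance\<close> is applied to each component difference, and
  \<open>power_balance\<close> sums the results. Absolute integrability of the inputs is a separate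
  premise because a trajectory only yields gauge integrability of the right-hand sides, which does
  not survive multiplication by a continuous function.\<close>

lemma energy_balance:
  assumes x: "trajectory S x0 u x" and y: "trajectory S y0 v y"
    and u: "\<And>p. p \<in> UX S \<Longrightarrow> (\<lambda>t. u t p) absolutely_integrable_on {0..T}"
    and v: "\<And>p. p \<in> UX S \<Longrightarrow> (\<lambda>t. v t p) absolutely_integrable_on {0..T}"
    and T: "0 \<le> T"
  shows "((\<lambda>t. power_flow S (x t) (y t) (u t) (v t)) has_integral (energy S (x T) (y T) - energy S x0 y0)) {0..T}"
proof -
  have cx: "continuous_states S {0..T} x" and cy: "continuous_states S {0..T} y"
    by (rule continuous_states_subset[OF trajectory_continuous]; use x y in auto)+
  note init = trajectory_initial[OF x] trajectory_initial[OF y]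
  define fV gV fE gE where "fV p t = fst (x t) p - fst (y t) p"
    and "gV p t = rhsV S (x t) (u t) p - rhsV S (y t) (v t) p"
    and "fE q t = snd (x t) q - snd (y t) q"
    and "gE q t = rhsE S (x t) (u t) q - rhsE S (y t) (v t) q" for p q t
  have V: "((\<lambda>t. fV p t * gV p t) has_integral ((fV p T)\<^sup>2 / 2 - (fV p 0)\<^sup>2 / 2)) {0..T}" if p: "p \<in> XV S" for p
  proof (rule square_balance)
    show "gV p absolutely_integrable_on {0..T}"
      unfolding gV_def by (intro set_integral_diff rhs_absolutely_integrable cx cy u v p)
    show "(gV p has_integral (fV p t - fV p 0)) {0..t}" if "t \<in> {0..T}" for t
    proof -
      have "(gV p has_integral ((fst (x t) p - fst x0 p) - (fst (y t) p - fst y0 p))) {0..t}"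
        unfolding gV_def using x y p that by (intro has_integral_diff) (auto simp: trajectory_def)
      then show ?thesis
        using init p by (simp add: fV_def algebra_simps)
    qed
    show "continuous_on {0..T} (fV p)"
      using cx cy p unfolding fV_def continuous_states_def by (intro continuous_on_diff) auto
  qed (rule T)
  have E: "((\<lambda>t. fE p t * gE p t) has_integral ((fE p T)\<^sup>2 / 2 - (fE p 0)\<^sup>2 / 2)) {0..T}" if p: "p \<in> XE S" for p
  proof (rule square_balance)
    show "gE p absolutely_integrable_on {0..T}"
      unfolding gE_def by (intro set_integral_diff rhs_absolutely_integrable cx cy u v p)
    show "(gE p has_integral (fE p t - fE p 0)) {0..t}" if "t \<in> {0..T}" for t
    proof -
      have "(gE p has_integral ((snd (x t) p - snd x0 p) - (snd (y t) p - snd y0 p))) {0..t}"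
        unfolding gE_def using x y p that by (intro has_integral_diff) (auto simp: trajectory_def)
      then show ?thesis
        using init p by (simp add: fE_def algebra_simps)
    qed
    show "continuous_on {0..T} (fE p)"
      using cx cy p unfolding fE_def continuous_states_def by (intro continuous_on_diff) auto
  qed (rule T)
  have "((\<lambda>t. (\<Sum>p\<in>XV S. fV p t * gV p t / bV S (fst p) (snd p)) + (\<Sum>q\<in>XE S. fE q t * gE q t / bE S (fst q) (snd q)))
      has_integral ((\<Sum>p\<in>XV S. ((fV p T)\<^sup>2 / 2 - (fV p 0)\<^sup>2 / 2) / bV S (fst p) (snd p))
        + (\<Sum>q\<in>XE S. ((fE q T)\<^sup>2 / 2 - (fE q 0)\<^sup>2 / 2) / bE S (fst q) (snd q)))) {0..T}"
    by (intro has_integral_add has_integral_sum has_integral_divide fin V E)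
  moreover have "(\<Sum>p\<in>XV S. fV p t * gV p t / bV S (fst p) (snd p)) + (\<Sum>q\<in>XE S. fE q t * gE q t / bE S (fst q) (snd q))
      = power_flow S (x t) (y t) (u t) (v t)" for t
    using power_balance[of "x t" "y t" "u t" "v t"]
    by (simp add: fV_def gV_def fE_def gE_def power_flow_def case_prod_unfold)
  moreover have "(\<Sum>p\<in>XV S. ((fV p T)\<^sup>2 / 2 - (fV p 0)\<^sup>2 / 2) / bV S (fst p) (snd p))
        + (\<Sum>q\<in>XE S. ((fE q T)\<^sup>2 / 2 - (fE q 0)\<^sup>2 / 2) / bE S (fst q) (snd q))
      = energy S (x T) (y T) - energy S (x 0) (y 0)"
    by (simp only: fV_def fE_def energy_def case_prod_unfold diff_divide_distrib sum_subtractf prod.collapse)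
  moreover have "energy S (x 0) (y 0) = energy S x0 y0"
    unfolding energy_def using init by (intro arg_cong2[of _ _ _ _ "(+)"] sum.cong) auto
  ultimately show ?thesis
    by simp
qed

subsection \<open>Steady states\<close>

text \<open>Feasibility makes \<open>omega\<close> vanish, so the feed-forward term drops out and
  \<open>mu_tilde\<close> carries the whole multiplier; stationarity then says
  \<open>phi_tilde = 0\<close>.\<close>

lemma optimal_outputs:
  assumes opt: "optimal_pair S \<theta>s \<mu>s" and out: "outputs_at S xe \<theta>s \<mu>s"
  shows "i \<in> nodes S \<Longrightarrow> theta S xe i = \<theta>s i"
    and "j \<in> edges S \<Longrightarrow> omega S xe j = 0"
    and "j \<in> edges S \<Longrightarrow> mu_tilde S xe j = \<mu>s j"
    and "i \<in> nodes S \<Longrightarrow> phi_tilde S xe i = 0"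
proof -
  show th: "theta S xe i = \<theta>s i" if "i \<in> nodes S" for i
    using out that by (simp add: outputs_at_def)
  show om: "omega S xe j = 0" if "j \<in> edges S" for j
    using opt that by (simp add: omega_eq th optimal_pair_def feasible_def mtx_vec_def trans_mtx_def)
  have mu: "mu_tilde S xe j = \<mu>s j" if "j \<in> edges S" for j
  proof -
    have "(diag_mtx (dE S) \<cdot>\<^bsub>edges S\<^esub> omega S xe) j = 0"
      unfolding mtx_vec_def by (intro sum.neutral) (simp add: om)
    moreover have "mu S xe j = \<mu>s j"
      using out that by (simp add: outputs_at_def)
    ultimately show ?thesis
      by (simp add: mu_def)
  qed
  then show "j \<in> edges S \<Longrightarrow> mu_tilde S xe j = \<mu>s j" .
  show "phi_tilde S xe i = 0" if "i \<in> nodes S" for i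
  proof -
    have "grad_obj S \<theta>s i + (\<Sum>j\<in>edges S. incidence S i j * \<mu>s j) = 0"
      using opt that by (simp add: optimal_pair_def mtx_vec_def)
    then show ?thesis
      using that by (simp add: phi_tilde_eq mu th grad_obj_def)
  qed
qed

text \<open>This makes the equilibrium an admissible second trajectory, with zero input, so that
  \<open>energy_balance\<close> also measures the distance to it.\<close>

lemma optimal_outputs_trajectory:
  assumes opt: "optimal_pair S \<theta>s \<mu>s" and out: "outputs_at S xe \<theta>s \<mu>s"
  shows "trajectory S xe (\<lambda>_ _. 0) (\<lambda>_. xe)"
proof -
  note facts = optimal_outputs[OF opt out]
  have "rhsV S xe (\<lambda>_. 0) p = 0" if "p \<in> XV S" for p
    using that facts by (cases p) (simp add: rhsV_eq)
  moreover have "rhsE S xe (\<lambda>_. 0) p = 0" if "p \<in> XE S" for p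
    using that facts by (cases p) (simp add: rhsE_eq)
  ultimately show ?thesis
    by (simp add: trajectory_def)
qed

text \<open>The outputs alone do not fix the components with \<open>k \<ge> 2\<close>. Under the
  feedback, though, the right-hand side of such a component reduces to its gain times its own input,
  so that input is zero; its weight is positive, hence the component vanishes.\<close>

lemma feedback_rest_point:
  assumes opt: "optimal_pair S \<theta>s \<mu>s" and out: "outputs_at S xe \<theta>s \<mu>s"
    and rest: "rest_point S xe (U_fb S xe)" and p: "p \<in> UX S"
  shows "port_output S xe p = 0"
proof -
  note facts = optimal_outputs[OF opt out]
  note fb = U_fb_eq
  \<comment> \<open>Edge inputs enter every node equation and have to be removed before the inputs
    of the single components can be isolated.\<close>
  have edge: "U_fb S xe (Inl (Inr j)) = 0" if "j \<in> edges S" for j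
  proof -
    have "Inl (Inr j) \<in> UX S" using that by auto
    from fb[OF this] show ?thesis using that facts by (simp add: port_output_def)
  qed
  consider (V) i k where "p = Inl (Inl (i, k))" "(i, k) \<in> KV S" | (D) j where "p = Inl (Inr j)" "j \<in> edges S"
    | (E) j k where "p = Inr (j, k)" "(j, k) \<in> KE S"
    using p by auto
  then show ?thesis
  proof cases
    case V
    then have ik: "(i, k) \<in> XV S" and "2 \<le> k" "i \<in> nodes S" by auto
    have "0 = rhsV S xe (U_fb S xe) (i, k)"
      using rest ik by (simp add: rest_point_def)
    also have "\<dots> = bV S i k * U_fb S xe p"
      using \<open>2 \<le> k\<close> \<open>i \<in> nodes S\<close> V(1) by (simp add: rhsV_eq[OF ik] facts edge)
    finally have "U_fb S xe p = 0"
      using gains_pos(1)[of i k] ik by auto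
    moreover have "input_weight S p > 0"
      using gains_pos(1,2)[of i k] V ik by (auto simp: input_weight_def)
    ultimately show ?thesis
      using fb[OF p] by simp
  next
    case D
    then show ?thesis by (simp add: port_output_def facts)
  next
    case E
    then have jk: "(j, k) \<in> XE S" and "2 \<le> k" "j \<in> edges S" by auto
    have "0 = rhsE S xe (U_fb S xe) (j, k)"
      using rest jk by (simp add: rest_point_def)
    also have "\<dots> = bE S j k * U_fb S xe p"
      using \<open>2 \<le> k\<close> \<open>j \<in> edges S\<close> E(1) by (simp add: rhsE_eq[OF jk] facts)
    finally have "U_fb S xe p = 0"
      using gains_pos(3)[of j k] jk by auto
    moreover have "input_weight S p > 0"
      using gains_pos(3,4)[of j k] E jk by (auto simp: input_weight_def)
    ultimately show ?thesis
      using fb[OF p] by simp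
  qed
qed

text \<open>When the port output vanishes, only the component \<open>k = 1\<close> is left at each
  node and edge, and it must carry the whole of \<open>\<theta>s i\<close> or
  \<open>\<mu>s j\<close>.\<close>

lemma outputs_determine_state:
  assumes opt: "optimal_pair S \<theta>s \<mu>s"
    and "outputs_at S x \<theta>s \<mu>s" "outputs_at S y \<theta>s \<mu>s"
    and zero: "\<And>p. p \<in> UX S \<Longrightarrow> port_output S x p = 0" "\<And>p. p \<in> UX S \<Longrightarrow> port_output S y p = 0"
  shows "p \<in> XV S \<Longrightarrow> fst x p = fst y p" and "q \<in> XE S \<Longrightarrow> snd x q = snd y q"
proof -
  have rho: "i \<in> nodes S \<Longrightarrow> 1 \<le> rhoV S i" "j \<in> edges S \<Longrightarrow> 1 \<le> rhoE S j" for i j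
    using setting by (auto simp: pd_setting_def admissible_gains_def)
  have V: "fst z (i, k) = (if k = 1 then \<theta>s i else 0)"
    if z: "outputs_at S z \<theta>s \<mu>s" "\<And>p. p \<in> UX S \<Longrightarrow> port_output S z p = 0" and ik: "(i, k) \<in> XV S" for z i k
  proof -
    have 0: "fst z (i, l) = 0" if "l \<in> {2..rhoV S i}" for l
    proof -
      have "Inl (Inl (i, l)) \<in> UX S" using that ik by auto
      from z(2)[OF this] show ?thesis by (simp add: port_output_def)
    qed
    have "\<theta>s i = fst z (i, 1) + (\<Sum>l=2..rhoV S i. fst z (i, l))"
      using optimal_outputs(1)[OF opt z(1), of i] ik rho(1)[of i]
      by (simp add: theta_eq sum.atLeast_Suc_atMost numeral_2_eq_2)
    then have "\<theta>s i = fst z (i, 1)"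
      by (simp add: 0)
    then show ?thesis using 0[of k] ik by auto
  qed
  have E: "snd z (j, k) = (if k = 1 then \<mu>s j else 0)"
    if z: "outputs_at S z \<theta>s \<mu>s" "\<And>p. p \<in> UX S \<Longrightarrow> port_output S z p = 0" and jk: "(j, k) \<in> XE S" for z j k
  proof -
    have 0: "snd z (j, l) = 0" if "l \<in> {2..rhoE S j}" for l
    proof -
      have "Inr (j, l) \<in> UX S" using that jk by auto
      from z(2)[OF this] show ?thesis by (simp add: port_output_def)
    qed
    have "\<mu>s j = snd z (j, 1) + (\<Sum>l=2..rhoE S j. snd z (j, l))"
      using optimal_outputs(3)[OF opt z(1), of j] jk rho(2)[of j]
      by (simp add: mu_tilde_eq sum.atLeast_Suc_atMost numeral_2_eq_2)
    then have "\<mu>s j = snd z (j, 1)"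
      by (simp add: 0)
    then show ?thesis using 0[of k] jk by auto
  qed
  show "p \<in> XV S \<Longrightarrow> fst x p = fst y p"
    using V[OF assms(2) zero(1)] V[OF assms(3) zero(2)] by (cases p) auto
  show "q \<in> XE S \<Longrightarrow> snd x q = snd y q"
    using E[OF assms(2) zero(1)] E[OF assms(3) zero(2)] by (cases q) auto
qed

subsection \<open>The cost of a stabilizing control\<close>

lemma excess_cost_nonneg: "excess_cost S x u \<ge> 0"
  unfolding excess_cost_def
  by (intro sum_nonneg divide_nonneg_nonneg input_weight_nonneg) auto

lemma integral_excess_cost_nonneg: "0 \<le> (\<integral>t. excess_cost S (y t) (u t) \<partial>M)"
  by (rule Bochner_Integration.integral_nonneg) (rule excess_cost_nonneg)

lemma running_cost_nonneg: "running_cost S xe x u \<ge> 0"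
  unfolding running_cost_def
  by (intro add_nonneg_nonneg sum_nonneg divide_nonneg_nonneg mult_nonneg_nonneg
      input_weight_nonneg grad_gap_nonneg) auto

lemma running_cost_ge_input: "p \<in> UX S \<Longrightarrow> (u p)\<^sup>2 / input_weight S p \<le> running_cost S xe x u"
  and running_cost_ge_output:
    "p \<in> UX S \<Longrightarrow> input_weight S p / 4 * (port_output S x p)\<^sup>2 \<le> running_cost S xe x u"
proof -
  assume p: "p \<in> UX S"
  have 1: "(u p)\<^sup>2 / input_weight S p \<le> (\<Sum>p\<in>UX S. (u p)\<^sup>2 / input_weight S p)"
    by (rule member_le_sum[OF p]) (use fin in \<open>auto intro!: divide_nonneg_nonneg input_weight_nonneg\<close>)
  have 2: "input_weight S p / 4 * (port_output S x p)\<^sup>2 \<le> (\<Sum>p\<in>UX S. input_weight S p / 4 * (port_output S x p)\<^sup>2)"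
    by (rule member_le_sum[OF p]) (use fin in \<open>auto intro!: mult_nonneg_nonneg input_weight_nonneg\<close>)
  have 3: "0 \<le> (\<Sum>p\<in>UX S. (u p)\<^sup>2 / input_weight S p)" "0 \<le> (\<Sum>p\<in>UX S. input_weight S p / 4 * (port_output S x p)\<^sup>2)"
    by (intro sum_nonneg divide_nonneg_nonneg mult_nonneg_nonneg input_weight_nonneg; simp)+
  show "(u p)\<^sup>2 / input_weight S p \<le> running_cost S xe x u"
    "input_weight S p / 4 * (port_output S x p)\<^sup>2 \<le> running_cost S xe x u"
    using 1 2 3 grad_gap_nonneg[of x xe] unfolding running_cost_def by linarith+
qed

section \<open>The cost relative to an equilibrium with zero port output\<close>

context
  fixes \<theta>s \<mu>s and xe :: "('v, 'e) state"
  assumes opt: "optimal_pair S \<theta>s \<mu>s" and out: "outputs_at S xe \<theta>s \<mu>s"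
    and at_rest: "\<forall>p\<in>UX S. port_output S xe p = 0"
begin

lemma cost_eq:
  "cost S \<theta>s U y = (\<integral>\<^sup>+t. (if admissible_input S (U t y) then ennreal (running_cost S xe (y t) (U t y)) else \<infinity>) \<partial>lebesgue_on {0..})"
proof -
  have "wnorm2 (UX S) (R_inv S) u + ennreal (qV S \<theta>s x + qE S x) =
      (if admissible_input S u then ennreal (running_cost S xe x u) else \<infinity>)" for u x
  proof -
    have "0 \<le> (\<Sum>p\<in>UX S. (u p)\<^sup>2 / input_weight S p)"
      by (intro sum_nonneg divide_nonneg_nonneg input_weight_nonneg) auto
    moreover have "0 \<le> (\<Sum>p\<in>UX S. input_weight S p / 4 * (port_output S x p)\<^sup>2) + grad_gap S x xe"
      by (intro add_nonneg_nonneg sum_nonneg mult_nonneg_nonneg divide_nonneg_nonneg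
          input_weight_nonneg grad_gap_nonneg) auto
    moreover have "wnorm2 (UX S) (R_inv S) u =
        (if admissible_input S u then ennreal (\<Sum>p\<in>UX S. (u p)\<^sup>2 / input_weight S p) else \<infinity>)"
      unfolding admissible_input_def by (rule wnorm2_diagonal[OF fin(7) R_inv_eq])
    moreover have "qV S \<theta>s x + qE S x =
        (\<Sum>p\<in>UX S. input_weight S p / 4 * (port_output S x p)\<^sup>2) + grad_gap S x xe"
      by (rule state_cost_eq[OF optimal_outputs(1)[OF opt out]])
    ultimately show ?thesis
      unfolding running_cost_def
      by (cases "admissible_input S u") (simp_all only: ennreal_plus if_True if_False infinity_ennreal_def add_top_left_ennreal)
  qed
  then show ?thesis
    unfolding cost_def by (simp add: nn_integral_restrict_space)
qed

text \<open>Completing the square: the mixed term is the power supplied through the port, and the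
  gradient gap of the cost is the dissipation in \<open>power_flow\<close>. The output of
  \<open>xe\<close> disappears by \<open>at_rest\<close>.\<close>

lemma running_cost_eq:
  assumes "admissible_input S u"
  shows "running_cost S xe x u = excess_cost S x u - power_flow S x xe u (\<lambda>_. 0)"
proof -
  \<comment> \<open>For \<open>s = 0\<close> both sides are 0, by \<open>u p = 0\<close> and
    division by zero.\<close>
  have "(u p)\<^sup>2 / s + s / 4 * z\<^sup>2 = (u p + s / 2 * z)\<^sup>2 / s - z * u p"
    if "s = 0 \<longrightarrow> u p = 0" for p z and s :: real
    using that by (cases "s = 0") (auto simp: field_simps power2_eq_square)
  then have "(\<Sum>p\<in>UX S. (u p)\<^sup>2 / input_weight S p) + (\<Sum>p\<in>UX S. input_weight S p / 4 * (port_output S x p)\<^sup>2)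
      = excess_cost S x u - (\<Sum>p\<in>UX S. port_output S x p * u p)"
    unfolding excess_cost_def sum.distrib[symmetric] sum_subtractf[symmetric]
    using assms by (intro sum.cong refl) (simp add: admissible_input_def)
  moreover have "power_flow S x xe u (\<lambda>_. 0) = (\<Sum>p\<in>UX S. port_output S x p * u p) - grad_gap S x xe"
    unfolding power_flow_def by (simp add: at_rest cong: sum.cong)
  ultimately show ?thesis
    unfolding running_cost_def by linarith
qed

lemma measurable_costs:
  assumes y: "continuous_states S {0..} y"
    and U: "\<And>p. p \<in> UX S \<Longrightarrow> (\<lambda>t. u t p) \<in> borel_measurable (lebesgue_on {0..})"
  shows "(\<lambda>t. running_cost S xe (y t) (u t)) \<in> borel_measurable (lebesgue_on {0..})"
    and "(\<lambda>t. excess_cost S (y t) (u t)) \<in> borel_measurable (lebesgue_on {0..})"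
    and "(\<lambda>t. if admissible_input S (u t) then ennreal (running_cost S xe (y t) (u t)) else \<infinity>) \<in> borel_measurable (lebesgue_on {0..})"
proof -
  have z: "(\<lambda>t. port_output S (y t) p) \<in> borel_measurable (lebesgue_on {0..})" if "p \<in> UX S" for p
    by (intro continuous_imp_measurable_on_sets_lebesgue continuous_port_output[OF y that]) auto
  have g: "(\<lambda>t. grad_gap S (y t) xe) \<in> borel_measurable (lebesgue_on {0..})"
    by (intro continuous_imp_measurable_on_sets_lebesgue continuous_grad_gap[OF y])
      (auto simp: continuous_states_def)
  show r: "(\<lambda>t. running_cost S xe (y t) (u t)) \<in> borel_measurable (lebesgue_on {0..})"
    unfolding running_cost_def
    by (intro borel_measurable_add borel_measurable_sum borel_measurable_divide borel_measurable_times
        borel_measurable_power borel_measurable_const z g U)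
  show "(\<lambda>t. excess_cost S (y t) (u t)) \<in> borel_measurable (lebesgue_on {0..})"
    unfolding excess_cost_def
    by (intro borel_measurable_add borel_measurable_sum borel_measurable_divide borel_measurable_times
        borel_measurable_power borel_measurable_const z U)
  have "Measurable.pred (lebesgue_on {0..}) (\<lambda>t. input_weight S p = 0 \<longrightarrow> u t p = 0)" if "p \<in> UX S" for p
  proof -
    note U[OF that, measurable]
    show ?thesis by measurable
  qed
  then have "Measurable.pred (lebesgue_on {0..}) (\<lambda>t. admissible_input S (u t))"
    unfolding admissible_input_def by (intro pred_intros_finite fin)
  with r show "(\<lambda>t. if admissible_input S (u t) then ennreal (running_cost S xe (y t) (u t)) else \<infinity>) \<in> borel_measurable (lebesgue_on {0..})"
    by measurable
qed

lemma stabilizingD: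
  assumes "stabilizing S x0 \<theta>s \<mu>s U y"
  shows "trajectory S x0 (\<lambda>t. U t y) y" "continuous_states S {0..} y"
    and "\<And>p. p \<in> UX S \<Longrightarrow> (\<lambda>t. U t y p) \<in> borel_measurable (lebesgue_on {0..})"
  using assms trajectory_continuous unfolding stabilizing_def by blast+

text \<open>Finite cost makes the input admissible almost everywhere and bounds
  \<open>u\<^sup>2\<close> by \<open>s\<close> times the running cost, which supplies the
  integrability demanded by \<open>energy_balance\<close>. Integrating
  \<open>running_cost_eq\<close> over \<open>{0..T}\<close> then gives the last two claims; the
  final one is an inequality because the cost after \<open>T\<close> is kept on the right.\<close>

lemma finite_cost_bounds:
  assumes stab: "stabilizing S x0 \<theta>s \<mu>s U y" and finite_cost: "cost S \<theta>s U y < \<infinity>" and T: "0 \<le> T"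
  shows "AE t in lebesgue_on {0..T}. admissible_input S (U t y)"
    and "\<And>p. p \<in> UX S \<Longrightarrow> (\<lambda>t. U t y p) absolutely_integrable_on {0..T}"
    and "integrable (lebesgue_on {0..T}) (\<lambda>t. excess_cost S (y t) (U t y))"
    and "(\<integral>t. excess_cost S (y t) (U t y) \<partial>lebesgue_on {0..T}) + energy S x0 xe
      \<le> enn2real (cost S \<theta>s U y) + energy S (y T) xe"
proof -
  note traj = stabilizingD(1)[OF stab] and cont = stabilizingD(2)[OF stab] and meas = stabilizingD(3)[OF stab]
  let ?M = "lebesgue_on {0..T}"
  let ?stage = "\<lambda>t. if admissible_input S (U t y) then ennreal (running_cost S xe (y t) (U t y)) else \<infinity>"
  let ?L = "\<lambda>t. running_cost S xe (y t) (U t y)"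
  have restr: "f \<in> borel_measurable ?M" if "f \<in> borel_measurable (lebesgue_on {0..})" for f :: "real \<Rightarrow> 'c::topological_space"
    using that by (rule measurable_restrict_mono) auto
  note mcost = measurable_costs[OF cont meas]
  have "AE t in lebesgue_on {0..}. ?stage t \<noteq> \<infinity>"
    using finite_cost by (intro nn_integral_PInf_AE mcost) (simp_all add: cost_eq[symmetric])
  then have "AE t in lebesgue_on {0..}. admissible_input S (U t y)"
    by eventually_elim (auto split: if_splits)
  then show ae: "AE t in ?M. admissible_input S (U t y)"
    by (rule AE_lebesgue_on_subset) auto
  have "(\<integral>\<^sup>+t. ennreal (?L t) \<partial>?M) = (\<integral>\<^sup>+t. ?stage t \<partial>?M)"
    using ae by (intro nn_integral_cong_AE) (auto elim: eventually_mono)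
  also have "\<dots> \<le> cost S \<theta>s U y"
    unfolding cost_eq by (rule nn_integral_lebesgue_on_mono) auto
  finally have le_cost: "(\<integral>\<^sup>+t. ennreal (?L t) \<partial>?M) \<le> cost S \<theta>s U y" .
  have L: "integrable ?M ?L"
    using le_cost finite_cost by (intro integrableI_nonneg restr mcost) (auto simp: running_cost_nonneg)
  have L_le: "integral\<^sup>L ?M ?L \<le> enn2real (cost S \<theta>s U y)"
  proof -
    have "ennreal (integral\<^sup>L ?M ?L) \<le> cost S \<theta>s U y"
      using le_cost nn_integral_eq_integral[OF L] by (simp add: running_cost_nonneg)
    then have "enn2real (ennreal (integral\<^sup>L ?M ?L)) \<le> enn2real (cost S \<theta>s U y)"
      using finite_cost by (intro enn2real_mono) auto
    then show ?thesis
      by (simp add: running_cost_nonneg)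
  qed
  show u: "(\<lambda>t. U t y p) absolutely_integrable_on {0..T}" if p: "p \<in> UX S" for p
    unfolding absolutely_integrable_on_iff_integrable
  proof (rule Bochner_Integration.integrable_bound)
    show "integrable ?M (\<lambda>t. 1 + input_weight S p * ?L t)"
      using L by (intro Bochner_Integration.integrable_add integrable_mult_right) auto
    show "(\<lambda>t. U t y p) \<in> borel_measurable ?M"
      by (intro restr meas p)
    show "AE t in ?M. norm (U t y p) \<le> norm (1 + input_weight S p * ?L t)"
      using ae
    proof eventually_elim
      case (elim t)
      have s: "input_weight S p \<ge> 0"
        by (rule input_weight_nonneg[OF p])
      have "(U t y p)\<^sup>2 \<le> input_weight S p * ?L t"
      proof (cases "input_weight S p = 0")
        case True
        then show ?thesis using elim p by (auto simp: admissible_input_def)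
      next
        case False
        then show ?thesis
          using running_cost_ge_input[OF p, of "U t y" xe "y t"] s by (simp add: divide_le_eq mult.commute)
      qed
      \<comment> \<open>From \<open>(\<bar>u\<bar> - 1)\<^sup>2 \<ge> 0\<close>. Only integrability
        of the input is needed here, so the crude constant 1 is good enough on a bounded
        interval.\<close>
      moreover have "\<bar>U t y p\<bar> \<le> 1 + (U t y p)\<^sup>2"
        using sum_squares_ge_zero[of "\<bar>U t y p\<bar> - 1" 0] by (simp add: power2_eq_square algebra_simps)
      moreover have "0 \<le> input_weight S p * ?L t"
        using s running_cost_nonneg by (intro mult_nonneg_nonneg)
      ultimately show ?case by simp
    qed
  qed
  let ?P = "\<lambda>t. power_flow S (y t) xe (U t y) (\<lambda>_. 0)"
  have P_abs: "?P absolutely_integrable_on {0..T}"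
    by (intro power_flow_absolutely_integrable continuous_states_subset[OF cont] u)
      (auto simp: continuous_states_def)
  have P: "integrable ?M ?P"
    using P_abs by (simp add: absolutely_integrable_on_iff_integrable)
  have "(?P has_integral (energy S (y T) xe - energy S x0 xe)) {0..T}"
    using energy_balance[OF traj optimal_outputs_trajectory[OF opt out] u _ T] by simp
  then have P_eq: "integral\<^sup>L ?M ?P = energy S (y T) xe - energy S x0 xe"
    using lebesgue_integral_eq_integral[OF P] integral_unique by auto
  have W: "AE t in ?M. excess_cost S (y t) (U t y) = ?L t + ?P t"
    using ae by eventually_elim (simp add: running_cost_eq)
  show "integrable ?M (\<lambda>t. excess_cost S (y t) (U t y))"
    by (subst integrable_cong_AE[OF restr[OF mcost(2)] _ W])
      (use L P in \<open>auto intro: borel_measurable_integrable\<close>)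
  have "integral\<^sup>L ?M (\<lambda>t. excess_cost S (y t) (U t y)) = integral\<^sup>L ?M (\<lambda>t. ?L t + ?P t)"
    by (intro integral_cong_AE[OF restr[OF mcost(2)] _ W]) (use L P in \<open>auto intro: borel_measurable_integrable\<close>)
  also have "\<dots> = integral\<^sup>L ?M ?L + (energy S (y T) xe - energy S x0 xe)"
    using L P by (simp add: P_eq)
  finally show "integral\<^sup>L ?M (\<lambda>t. excess_cost S (y t) (U t y)) + energy S x0 xe
      \<le> enn2real (cost S \<theta>s U y) + energy S (y T) xe"
    using L_le by linarith
qed

text \<open>A limit with nonzero port output would keep the state cost above a positive constant
  from some time on, making the total cost infinite. So the limit has zero output and, by
  \<open>outputs_determine_state\<close>, agrees with \<open>xe\<close>.\<close>

lemma finite_cost_energy_tendsto: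
  assumes stab: "stabilizing S x0 \<theta>s \<mu>s U y" and finite_cost: "cost S \<theta>s U y < \<infinity>"
  shows "((\<lambda>T. energy S (y T) xe) \<longlongrightarrow> 0) at_top"
proof -
  obtain ye where conv: "converges_to S y ye" and out': "outputs_at S ye \<theta>s \<mu>s"
    using stab by (auto simp: stabilizing_def)
  have limV: "((\<lambda>t. fst (y t) p) \<longlongrightarrow> fst ye p) at_top" if "p \<in> XV S" for p
    using conv that unfolding converges_to_def by blast
  have limE: "((\<lambda>t. snd (y t) p) \<longlongrightarrow> snd ye p) at_top" if "p \<in> XE S" for p
    using conv that unfolding converges_to_def by blast
  have zero: "port_output S ye p = 0" if p: "p \<in> UX S" for p
  proof (rule ccontr)
    let ?z = "port_output S ye p" and ?s = "input_weight S p"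
    assume nz: "?z \<noteq> 0"
    have "((\<lambda>t. port_output S (y t) p) \<longlongrightarrow> ?z) at_top \<and> ?s > 0"
    proof -
      consider (V) i k where "p = Inl (Inl (i, k))" "(i, k) \<in> KV S" | (D) j where "p = Inl (Inr j)" "j \<in> edges S"
        | (E) j k where "p = Inr (j, k)" "(j, k) \<in> KE S"
        using p by auto
      then show ?thesis
      proof cases
        case V
        then have "(i, k) \<in> XV S" by auto
        then show ?thesis
          using limV[of "(i, k)"] gains_pos(1,2)[of i k] V by (auto simp: port_output_def input_weight_def)
      next
        \<comment> \<open>The weight may be 0 here, but the output is excluded from being nonzero:
          \<open>omega\<close> vanishes at optimal outputs.\<close>
        case D
        then show ?thesis
          using nz optimal_outputs(2)[OF opt out'] by (simp add: port_output_def)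
      next
        case E
        then have "(j, k) \<in> XE S" by auto
        then show ?thesis
          using limE[of "(j, k)"] gains_pos(3,4)[of j k] E by (auto simp: port_output_def input_weight_def)
      qed
    qed
    then have lim: "((\<lambda>t. ?s / 4 * (port_output S (y t) p)\<^sup>2) \<longlongrightarrow> ?s / 4 * ?z\<^sup>2) at_top" and s: "?s > 0"
      by (auto intro!: tendsto_intros)
    \<comment> \<open>Half the limit of the cost contribution of \<open>p\<close>, so the
      contribution eventually exceeds it.\<close>
    define c where "c = ?s / 8 * ?z\<^sup>2"
    have c: "c > 0" "c < ?s / 4 * ?z\<^sup>2"
      using s nz by (auto simp: c_def)
    obtain T0 where T0: "\<And>t. t \<ge> T0 \<Longrightarrow> c < ?s / 4 * (port_output S (y t) p)\<^sup>2"
      using order_tendstoD(1)[OF lim c(2)] unfolding eventually_at_top_linorder by blast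
    define T1 where "T1 = max 0 T0"
    have bound: "ennreal (c * n) \<le> cost S \<theta>s U y" if n: "n \<ge> 0" for n
    proof -
      have "ennreal (c * n) = (\<integral>\<^sup>+t. ennreal c * indicator {T1..T1 + n} t \<partial>lebesgue)"
        using c n by (simp add: nn_integral_cmult_indicator ennreal_mult)
      also have "\<dots> = (\<integral>\<^sup>+t. ennreal c \<partial>lebesgue_on {T1..T1 + n})"
        by (subst nn_integral_restrict_space) auto
      also have "\<dots> \<le> (\<integral>\<^sup>+t. (if admissible_input S (U t y) then ennreal (running_cost S xe (y t) (U t y)) else \<infinity>)
          \<partial>lebesgue_on {T1..T1 + n})"
      proof (rule nn_integral_mono)
        fix t assume "t \<in> space (lebesgue_on {T1..T1 + n})"
        then have "t \<ge> T0" by (auto simp: T1_def)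
        from T0[OF this] running_cost_ge_output[OF p, of "y t" xe "U t y"]
        have "c \<le> running_cost S xe (y t) (U t y)" by linarith
        then show "ennreal c \<le> (if admissible_input S (U t y) then ennreal (running_cost S xe (y t) (U t y)) else \<infinity>)"
          by (auto intro: ennreal_leI)
      qed
      also have "\<dots> \<le> cost S \<theta>s U y"
        unfolding cost_eq by (rule nn_integral_lebesgue_on_mono) (auto simp: T1_def)
      finally show ?thesis .
    qed
    obtain C where C: "C \<ge> 0" "cost S \<theta>s U y = ennreal C"
      using finite_cost by (cases "cost S \<theta>s U y") auto
    \<comment> \<open>The interval length is chosen so that the lower bound becomes
      \<open>C + 1\<close>.\<close>
    have "c * ((C + 1) / c) \<le> C"
      using bound[of "(C + 1) / c"] C c by (simp add: ennreal_le_iff)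
    then show False
      using c by simp
  qed
  note same = outputs_determine_state[OF opt out' out zero bspec[OF at_rest]]
  have "((\<lambda>T. energy S (y T) xe) \<longlongrightarrow> energy S ye xe) at_top"
    unfolding energy_def case_prod_unfold prod.collapse divide_inverse
    by (intro tendsto_intros limV limE)
  moreover have "energy S ye xe = 0"
    unfolding energy_def case_prod_unfold prod.collapse using same by simp
  ultimately show ?thesis by simp
qed

text \<open>The excess cost is zero, so the running cost is the rate of energy loss. Its integral
  over \<open>{0..T}\<close> is the initial energy minus a nonnegative remainder, a bound
  independent of \<open>T\<close>.\<close>

lemma feedback_cost_le:
  assumes stab: "stabilizing S x0 \<theta>s \<mu>s (\<lambda>t y. U_fb S (y t)) x"
  shows "cost S \<theta>s (\<lambda>t y. U_fb S (y t)) x \<le> ennreal (energy S x0 xe)"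
proof -
  note traj = stabilizingD(1)[OF stab] and cont = stabilizingD(2)[OF stab] and meas = stabilizingD(3)[OF stab]
  note fb = U_fb_eq
  let ?L = "\<lambda>t. running_cost S xe (x t) (U_fb S (x t))"
  have range: "admissible_input S (U_fb S y)" for y
    by (simp add: admissible_input_def fb)
  have excess: "excess_cost S y (U_fb S y) = 0" for y
    by (simp add: excess_cost_def fb)
  have abs: "(\<lambda>t. U_fb S (x t) p) absolutely_integrable_on {0..T}" if p: "p \<in> UX S" for p T
    unfolding fb[OF p]
    by (intro absolutely_integrable_continuous_real continuous_intros continuous_port_output[OF _ p]
        continuous_states_subset[OF cont]) auto
  have bound: "(\<integral>\<^sup>+t. ennreal (?L t) \<partial>lebesgue_on {0..T}) \<le> ennreal (energy S x0 xe)" if T: "T \<ge> 0" for T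
  proof -
    let ?P = "\<lambda>t. power_flow S (x t) xe (U_fb S (x t)) (\<lambda>_. 0)"
    have L: "?L = (\<lambda>t. - ?P t)"
      using running_cost_eq[OF range] by (simp add: excess)
    have "?P absolutely_integrable_on {0..T}"
      by (intro power_flow_absolutely_integrable continuous_states_subset[OF cont] abs)
        (auto simp: continuous_states_def)
    then have P: "integrable (lebesgue_on {0..T}) ?P"
      by (simp add: absolutely_integrable_on_iff_integrable)
    have "(?P has_integral (energy S (x T) xe - energy S x0 xe)) {0..T}"
      using energy_balance[OF traj optimal_outputs_trajectory[OF opt out] abs _ T] by simp
    then have "integral\<^sup>L (lebesgue_on {0..T}) ?P = energy S (x T) xe - energy S x0 xe"
      using lebesgue_integral_eq_integral[OF P] integral_unique by auto
    then have "integral\<^sup>L (lebesgue_on {0..T}) ?L = energy S x0 xe - energy S (x T) xe"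
      by (simp add: L)
    moreover have "(\<integral>\<^sup>+t. ennreal (?L t) \<partial>lebesgue_on {0..T}) = ennreal (integral\<^sup>L (lebesgue_on {0..T}) ?L)"
      using P by (intro nn_integral_eq_integral) (simp_all add: running_cost_nonneg, simp add: L)
    ultimately show ?thesis
      using energy_nonneg[of "x T" xe] by (simp add: ennreal_leI)
  qed
  have mL: "(\<lambda>t. ennreal (?L t)) \<in> borel_measurable (lebesgue_on {0..})"
    using measurable_costs(1)[OF cont meas] by simp
  have "cost S \<theta>s (\<lambda>t y. U_fb S (y t)) x = (\<integral>\<^sup>+t. ennreal (?L t) \<partial>lebesgue_on {0..})"
    by (simp add: cost_eq range)
  \<comment> \<open>Passage from bounded intervals to the half-line by monotone convergence of
    truncations.\<close>
  also have "\<dots> = (\<integral>\<^sup>+t. (SUP n. ennreal (?L t) * indicator {0..real n} t) \<partial>lebesgue_on {0..})"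
  proof (rule nn_integral_cong)
    fix t :: real assume "t \<in> space (lebesgue_on {0..})"
    then obtain n where "t \<in> {0..real n}"
      using real_arch_simple[of t] by auto
    then show "ennreal (?L t) = (SUP n. ennreal (?L t) * indicator {0..real n} t)"
      by (intro antisym SUP_upper2[of n] SUP_least) (auto simp: indicator_def)
  qed
  also have "\<dots> = (SUP n. \<integral>\<^sup>+t. ennreal (?L t) * indicator {0..real n} t \<partial>lebesgue_on {0..})"
  proof (rule nn_integral_monotone_convergence_SUP)
    show "incseq (\<lambda>n t. ennreal (?L t) * indicator {0..real n} t)"
      by (auto simp: incseq_def le_fun_def indicator_def)
    have "{0..real n} \<in> sets (lebesgue_on {0..})" for n
      by (auto simp: sets_restrict_space_iff)
    then show "(\<lambda>t. ennreal (?L t) * indicator {0..real n} t) \<in> borel_measurable (lebesgue_on {0..})" for n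
      using mL by (intro borel_measurable_times_ennreal borel_measurable_indicator)
  qed
  also have "\<dots> \<le> ennreal (energy S x0 xe)"
  proof (rule SUP_least)
    fix n
    have "(\<integral>\<^sup>+t. ennreal (?L t) * indicator {0..real n} t \<partial>lebesgue_on {0..}) = (\<integral>\<^sup>+t. ennreal (?L t) \<partial>lebesgue_on {0..real n})"
      by (subst (1 2) nn_integral_restrict_space) (auto intro!: nn_integral_cong simp: indicator_def)
    also have "\<dots> \<le> ennreal (energy S x0 xe)"
      by (rule bound) simp
    finally show "(\<integral>\<^sup>+t. ennreal (?L t) * indicator {0..real n} t \<partial>lebesgue_on {0..}) \<le> ennreal (energy S x0 xe)" .
  qed
  finally show ?thesis .
qed

text \<open>Drop the nonnegative excess in the bound on \<open>{0..T}\<close> and let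
  \<open>T\<close> tend to infinity; the terminal energy disappears.\<close>

lemma energy_le_cost:
  assumes stab: "stabilizing S x0 \<theta>s \<mu>s U y"
  shows "ennreal (energy S x0 xe) \<le> cost S \<theta>s U y"
proof (cases "cost S \<theta>s U y < \<infinity>")
  case True
  have "energy S x0 xe \<le> enn2real (cost S \<theta>s U y) + energy S (y T) xe" if "T \<ge> 0" for T
    using finite_cost_bounds(4)[OF stab True that]
      integral_excess_cost_nonneg[of "lebesgue_on {0..T}" y "\<lambda>t. U t y"] by linarith
  then have ev: "\<forall>\<^sub>F T in at_top. energy S x0 xe \<le> enn2real (cost S \<theta>s U y) + energy S (y T) xe"
    using eventually_ge_at_top[of 0] by (rule eventually_mono[rotated])
  have "((\<lambda>T. enn2real (cost S \<theta>s U y) + energy S (y T) xe) \<longlongrightarrow> enn2real (cost S \<theta>s U y) + 0) at_top"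
    by (intro tendsto_intros finite_cost_energy_tendsto[OF stab True])
  from tendsto_lowerbound[OF this ev] have "energy S x0 xe \<le> enn2real (cost S \<theta>s U y)"
    by simp
  then have "ennreal (energy S x0 xe) \<le> ennreal (enn2real (cost S \<theta>s U y))"
    by (rule ennreal_leI)
  also have "\<dots> = cost S \<theta>s U y"
    using True by simp
  finally show ?thesis .
next
  case False
  then show ?thesis by (simp add: not_less top_unique)
qed

text \<open>With the cost at most the initial energy, the excess up to any later time
  \<open>T'\<close> is at most the terminal energy at \<open>T'\<close>, which tends to 0. Thus
  every square in the excess vanishes almost everywhere.\<close>

lemma minimal_cost_feedback:
  assumes stab: "stabilizing S x0 \<theta>s \<mu>s U y"
    and minimal: "cost S \<theta>s U y \<le> ennreal (energy S x0 xe)"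
  shows "AE t in lebesgue_on {0..}. \<forall>p\<in>UX S. U t y p = U_fb S (y t) p"
proof -
  have fin_cost: "cost S \<theta>s U y < \<infinity>"
    using minimal ennreal_less_top unfolding infinity_ennreal_def by (rule order_le_less_trans)
  let ?W = "\<lambda>t. excess_cost S (y t) (U t y)"
  have C: "enn2real (cost S \<theta>s U y) \<le> energy S x0 xe"
    using enn2real_mono[OF minimal] energy_nonneg by simp
  have zero: "AE t in lebesgue_on {0..T}. \<forall>p\<in>UX S. U t y p = U_fb S (y t) p" if T: "T \<ge> 0" for T
  proof -
    have le: "integral\<^sup>L (lebesgue_on {0..T}) ?W \<le> energy S (y T') xe" if "T' \<ge> T" for T'
    proof -
      have T': "T' \<ge> 0" using T that by simp
      have i: "integrable (lebesgue_on {0..T}) ?W" "integrable (lebesgue_on {0..T'}) ?W"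
        using finite_cost_bounds(3)[OF stab fin_cost] T T' by auto
      have "ennreal (integral\<^sup>L (lebesgue_on {0..T}) ?W) \<le> ennreal (integral\<^sup>L (lebesgue_on {0..T'}) ?W)"
        using nn_integral_eq_integral[OF i(1)] nn_integral_eq_integral[OF i(2)]
          nn_integral_lebesgue_on_mono[of "{0..T}" "{0..T'}" "\<lambda>t. ennreal (?W t)"] that
        by (simp add: excess_cost_nonneg)
      then have "integral\<^sup>L (lebesgue_on {0..T}) ?W \<le> integral\<^sup>L (lebesgue_on {0..T'}) ?W"
        by (subst (asm) ennreal_le_iff) (rule integral_excess_cost_nonneg)
      then show ?thesis
        using finite_cost_bounds(4)[OF stab fin_cost T'] C by linarith
    qed
    \<comment> \<open>In \<open>le\<close> the left side does not depend on \<open>T'\<close>, while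
      the right side tends to 0.\<close>
    have "integral\<^sup>L (lebesgue_on {0..T}) ?W \<le> 0"
      by (rule tendsto_lowerbound[OF finite_cost_energy_tendsto[OF stab fin_cost]])
        (rule eventually_mono[OF eventually_ge_at_top[of T] le], simp_all)
    moreover have "integral\<^sup>L (lebesgue_on {0..T}) ?W \<ge> 0"
      by (rule integral_excess_cost_nonneg)
    ultimately have "AE t in lebesgue_on {0..T}. ?W t = 0"
      by (subst integral_nonneg_eq_0_iff_AE[symmetric])
        (auto simp: excess_cost_nonneg intro: finite_cost_bounds(3)[OF stab fin_cost T])
    with finite_cost_bounds(1)[OF stab fin_cost T] show ?thesis
    proof eventually_elim
      case (elim t)
      show ?case
      proof
        fix p assume p: "p \<in> UX S"
        have "(U t y p + input_weight S p / 2 * port_output S (y t) p)\<^sup>2 / input_weight S p = 0"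
          using elim(2) p sum_nonneg_eq_0_iff[OF fin(7),
            of "\<lambda>p. (U t y p + input_weight S p / 2 * port_output S (y t) p)\<^sup>2 / input_weight S p"]
            input_weight_nonneg
          unfolding excess_cost_def by (auto simp del: divide_eq_0_iff)
        \<comment> \<open>For positive weight the square is zero; for zero weight admissibility
          makes the input 0, as is the feedback.\<close>
        then show "U t y p = U_fb S (y t) p"
          using elim(1) p unfolding U_fb_eq[OF p] admissible_input_def by auto
      qed
    qed
  qed
  \<comment> \<open>The exceptional null set depends on \<open>T\<close>; integer horizons keep the
    union of these sets countable.\<close>
  have "AE t in lebesgue. \<forall>n::nat. t \<in> {0..real n} \<longrightarrow> (\<forall>p\<in>UX S. U t y p = U_fb S (y t) p)"
    unfolding AE_all_countable
  proof
    fix n :: nat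
    show "AE t in lebesgue. t \<in> {0..real n} \<longrightarrow> (\<forall>p\<in>UX S. U t y p = U_fb S (y t) p)"
      using zero[of "real n"] by (simp add: AE_restrict_space_iff)
  qed
  then have "AE t in lebesgue. t \<in> {0..} \<longrightarrow> (\<forall>p\<in>UX S. U t y p = U_fb S (y t) p)"
  proof eventually_elim
    case (elim t)
    obtain n where "t \<le> real n" using real_arch_simple by blast
    then show ?case using elim[rule_format, of n] by auto
  qed
  then show ?thesis
    by (simp add: AE_restrict_space_iff)
qed

text \<open>When both inputs are the feedback, each port contributes \<open>- s / 2\<close> times a
  squared output difference to the power flow, and \<open>grad_gap\<close> is subtracted as well.
  The energy starts at 0, so it stays there. The feedback law for \<open>u\<close> holds only almost
  everywhere, which suffices under the integral.\<close>

lemma feedback_trajectory_unique: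
  assumes x: "trajectory S x0 (\<lambda>t. U_fb S (x t)) x" and y: "trajectory S x0 u y"
    and fb: "AE t in lebesgue_on {0..}. \<forall>p\<in>UX S. u t p = U_fb S (y t) p"
    and u: "\<And>p T. p \<in> UX S \<Longrightarrow> 0 \<le> T \<Longrightarrow> (\<lambda>t. u t p) absolutely_integrable_on {0..T}"
    and T: "0 \<le> T"
  shows "energy S (y T) (x T) = 0"
proof -
  have cx: "continuous_states S {0..T} x" and cy: "continuous_states S {0..T} y"
    by (rule continuous_states_subset[OF trajectory_continuous]; use x y in auto)+
  have v: "(\<lambda>t. U_fb S (x t) p) absolutely_integrable_on {0..T}" if p: "p \<in> UX S" for p
    unfolding U_fb_eq[OF p]
    by (intro absolutely_integrable_continuous_real continuous_intros continuous_port_output[OF cx p])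
  let ?P = "\<lambda>t. power_flow S (y t) (x t) (u t) (U_fb S (x t))"
  have "?P absolutely_integrable_on {0..T}"
    by (intro power_flow_absolutely_integrable cx cy u v T)
  then have P: "integrable (lebesgue_on {0..T}) ?P"
    by (simp add: absolutely_integrable_on_iff_integrable)
  have "(?P has_integral (energy S (y T) (x T) - energy S x0 x0)) {0..T}"
    by (intro energy_balance[OF y x u v T] T)
  then have P_eq: "integral\<^sup>L (lebesgue_on {0..T}) ?P = energy S (y T) (x T)"
    using lebesgue_integral_eq_integral[OF P] integral_unique by (auto simp: energy_def)
  have fb': "AE t in lebesgue_on {0..T}. \<forall>p\<in>UX S. u t p = U_fb S (y t) p"
    by (rule AE_lebesgue_on_subset[OF fb]) auto
  have "AE t in lebesgue_on {0..T}. ?P t \<le> 0"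
    using fb'
  proof eventually_elim
    case (elim t)
    have "(port_output S (y t) p - port_output S (x t) p) * (u t p - U_fb S (x t) p) \<le> 0" if p: "p \<in> UX S" for p
    proof -
      have "u t p - U_fb S (x t) p = - (input_weight S p / 2 * (port_output S (y t) p - port_output S (x t) p))"
        using elim p by (simp add: U_fb_eq[OF p] right_diff_distrib diff_divide_distrib)
      then have "(port_output S (y t) p - port_output S (x t) p) * (u t p - U_fb S (x t) p)
          = - (input_weight S p / 2 * (port_output S (y t) p - port_output S (x t) p)\<^sup>2)"
        by (simp add: power2_eq_square)
      then show ?thesis
        using input_weight_nonneg[OF p] by simp
    qed
    then have "(\<Sum>p\<in>UX S. (port_output S (y t) p - port_output S (x t) p) * (u t p - U_fb S (x t) p)) \<le> 0"
      by (rule sum_nonpos)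
    then show ?case
      using grad_gap_nonneg[of "y t" "x t"] unfolding power_flow_def by linarith
  qed
  then have "integral\<^sup>L (lebesgue_on {0..T}) ?P \<le> integral\<^sup>L (lebesgue_on {0..T}) (\<lambda>_. 0)"
    by (intro integral_mono_AE P) auto
  then show ?thesis
    using energy_nonneg[of "y T" "x T"] P_eq by simp
qed

end

lemma energy_eq_0D:
  assumes "energy S x y = 0"
  shows "p \<in> XV S \<Longrightarrow> fst x p = fst y p" and "q \<in> XE S \<Longrightarrow> snd x q = snd y q"
proof -
  let ?V = "\<lambda>p. (fst x p - fst y p)\<^sup>2 / 2 / bV S (fst p) (snd p)"
  let ?E = "\<lambda>q. (snd x q - snd y q)\<^sup>2 / 2 / bE S (fst q) (snd q)"
  have b: "bV S (fst p) (snd p) > 0" if "p \<in> XV S" for p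
    using that gains_pos(1)[of "fst p" "snd p"] by auto
  have b': "bE S (fst q) (snd q) > 0" if "q \<in> XE S" for q
    using that gains_pos(3)[of "fst q" "snd q"] by auto
  have pos: "?V p \<ge> 0" if "p \<in> XV S" for p
    using b[OF that] by simp
  have pos': "?E q \<ge> 0" if "q \<in> XE S" for q
    using b'[OF that] by simp
  have "sum ?V (XV S) + sum ?E (XE S) = 0"
    using assms by (simp add: energy_def case_prod_unfold)
  moreover have "sum ?V (XV S) \<ge> 0" "sum ?E (XE S) \<ge> 0"
    by (rule sum_nonneg, erule pos) (rule sum_nonneg, erule pos')
  ultimately have sums: "sum ?V (XV S) = 0" "sum ?E (XE S) = 0"
    by linarith+
  have "\<forall>p\<in>XV S. ?V p = 0"
    by (rule sum_nonneg_eq_0_iff[THEN iffD1, OF fin(3)]) (erule pos, fact sums)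
  moreover have "\<forall>q\<in>XE S. ?E q = 0"
    by (rule sum_nonneg_eq_0_iff[THEN iffD1, OF fin(4)]) (erule pos', fact sums)
  ultimately have V: "\<And>p. p \<in> XV S \<Longrightarrow> ?V p = 0" and E: "\<And>q. q \<in> XE S \<Longrightarrow> ?E q = 0"
    by (simp_all only:)
  show "p \<in> XV S \<Longrightarrow> fst x p = fst y p"
    using V[of p] b[of p] by (simp del: mem_Sigma_iff)
  show "q \<in> XE S \<Longrightarrow> snd x q = snd y q"
    using E[of q] b'[of q] by (simp del: mem_Sigma_iff)
qed

end

text \<open>The optimal value is \<open>energy S x0 xe\<close>: the closed loop costs at most this,
  every stabilizing control at least this. Equality of costs thus puts any competitor under
  \<open>minimal_cost_feedback\<close>.\<close>

theorem proposition6: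
  fixes S :: "('v, 'e) pd_system"
    and x0 xe :: "('v, 'e) state"
    and x :: "real \<Rightarrow> ('v, 'e) state"
    and \<theta>s :: "'v vct" and \<mu>s :: "'e vct"
  assumes setting: "pd_setting S"
    and opt: "optimal_pair S \<theta>s \<mu>s"
    and closed_loop: "trajectory S x0 (\<lambda>t. U_fb S (x t)) x"
    and conv: "converges_to S x xe"
    and equil: "rest_point S xe (U_fb S xe)"
    and outputs: "outputs_at S xe \<theta>s \<mu>s"
  shows "is_optimal_control S x0 \<theta>s \<mu>s (\<lambda>t y. U_fb S (y t)) x"
proof -
  let ?U = "\<lambda>t y. U_fb S (y t)"
  have rest: "\<forall>p\<in>UX S. port_output S xe p = 0"
    using feedback_rest_point[OF setting opt outputs equil] by blast
  note ctx = setting opt outputs rest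
  have cont: "continuous_states S {0..} x"
    by (rule trajectory_continuous[OF setting closed_loop])
  have stab: "stabilizing S x0 \<theta>s \<mu>s ?U x"
    unfolding stabilizing_def
  proof (intro conjI ballI exI)
    show "causal ?U"
      by (auto simp: causal_def)
    show "(\<lambda>t. U_fb S (x t) p) \<in> borel_measurable (lebesgue_on {0..})" if p: "p \<in> UX S" for p
      unfolding U_fb_eq[OF setting p]
      by (intro continuous_imp_measurable_on_sets_lebesgue continuous_intros continuous_port_output[OF setting cont p]) auto
  qed (fact closed_loop conv equil outputs)+
  note le = feedback_cost_le[OF ctx stab]
  have ge: "ennreal (energy S x0 xe) \<le> cost S \<theta>s U' x'" if "stabilizing S x0 \<theta>s \<mu>s U' x'" for U' x'
    by (rule energy_le_cost[OF ctx that])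
  show ?thesis
    unfolding is_optimal_control_def
  proof (intro conjI allI ballI impI)
    show "cost S \<theta>s ?U x < \<infinity>"
      using le ennreal_less_top unfolding infinity_ennreal_def by (rule order_le_less_trans)
    show "cost S \<theta>s ?U x \<le> cost S \<theta>s U' x'" if "stabilizing S x0 \<theta>s \<mu>s U' x'" for U' x'
      using le ge[OF that] by (rule order_trans)
  next
    fix U' x' assume eq: "stabilizing S x0 \<theta>s \<mu>s U' x' \<and> cost S \<theta>s U' x' = cost S \<theta>s ?U x"
    then have stab': "stabilizing S x0 \<theta>s \<mu>s U' x'" and min: "cost S \<theta>s U' x' \<le> ennreal (energy S x0 xe)"
      using le by auto
    have fin': "cost S \<theta>s U' x' < \<infinity>"
      using min ennreal_less_top unfolding infinity_ennreal_def by (rule order_le_less_trans)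
    note fb = minimal_cost_feedback[OF ctx stab' min]
    have "energy S (x' t) (x t) = 0" if "t \<ge> 0" for t
      by (rule feedback_trajectory_unique[OF ctx closed_loop stabilizingD(1)[OF ctx stab'] fb
          finite_cost_bounds(2)[OF ctx stab' fin'] that])
    note same = energy_eq_0D[OF setting this]
    show "fst (x' t) p = fst (x t) p" if "0 \<le> t" "p \<in> XV S" for t p
      using same that by blast
    show "snd (x' t) p = snd (x t) p" if "0 \<le> t" "p \<in> XE S" for t p
      using same that by blast
    \<comment> \<open>The states are known to agree only on the index sets, so the feedback is
      compared through the port output, which depends on nothing else there.\<close>
    have fb_same: "U_fb S (x' t) p = U_fb S (x t) p" if "0 \<le> t" "p \<in> UX S" for t p
    proof -
      have "theta S (x' t) i = theta S (x t) i" if "i \<in> nodes S" for i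
        unfolding theta_eq[OF setting that] using same(1)[OF \<open>0 \<le> t\<close>] that by (intro sum.cong) auto
      then have "port_output S (x' t) p = port_output S (x t) p"
        using that(2) same[OF that(1)] by (auto simp: port_output_def omega_eq intro!: sum.cong)
      then show ?thesis
        by (simp add: U_fb_eq[OF setting that(2)])
    qed
    have "AE t in lebesgue. t \<in> {0..} \<longrightarrow> (\<forall>p\<in>UX S. U' t x' p = U_fb S (x' t) p)"
      using fb by (subst (asm) AE_restrict_space_iff) auto
    then have "AE t in lebesgue. t \<in> {0..} \<longrightarrow> (\<forall>p\<in>UX S. U' t x' p = U_fb S (x t) p)"
    proof eventually_elim
      case (elim t)
      show ?case
      proof (intro impI ballI)
        fix p assume "t \<in> {0..}" "p \<in> UX S"
        then show "U' t x' p = U_fb S (x t) p"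
          using elim fb_same[of t p] by (simp del: mem_Sigma_iff)
      qed
    qed
    then show "AE t in lebesgue_on {0..}. \<forall>p\<in>UX S. U' t x' p = U_fb S (x t) p"
      by (subst AE_restrict_space_iff) auto
  qed (fact stab)
qed

end
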